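(* (1) If $\Gamma\vdash t:A$ and $t\to_p r$, then $\Gamma\vdash r:A$. (2) If $\Gamma\Vdash t:A$ and $t\to^\circ r$, then $\Gamma\Vdash r:A$.
   Context: Two calculi. $\lambda_\rho$ has terms $t ::= x \mid \lambda x.t \mid tt \mid \rho^n \mid U^n t \mid \pi^n t \mid t\otimes t \mid (b^m,\rho^n) \mid \mathsf{letcase}\ x=r\ \mathsf{in}\ \{t_0,\dots,t_{2^m-1}\}$; $\lambda_\rho^\circ$ has the same terms except that $(b^m,\rho^n)$ is removed, $\mathsf{letcase}$ is replaced by $\mathsf{letcase}^\circ$, and sums $\sum_ip_it_i$ ($p_i\in(0,1]$, $\sum_ip_i=1$, modulo AC) are added. Here $\rho^n$ is a density matrix of $n$ qubits, $U^n$ a unitary, $\pi^m=\{\pi_0,\dots,\pi_{2^m-1}\}$ the computational-basis measurement, $0\le b^m<2^m$, $\overline{U^m}=U^m\otimes I^{n-m}$, $\overline{\pi_i}=\pi_i\otimes I^{n-m}$. Types $A::= n\mid(m,n)\mid A\multimap A$. Affine typing $\vdash$ for $\lambda_\rho$: $\Gamma,x:A\vdash x:A$; $\Gamma,x:A\vdash t:B\Rightarrow\Gamma\vdash\lambda x.t:A\multimap B$; $\Gamma\vdash t:A\multimap B$, $\Delta\vdash r:A\Rightarrow\Gamma,\Delta\vdash tr:B$; $\Gamma\vdash\rho^n:n$; $\Gamma\vdash t:n\Rightarrow\Gamma\vdash U^mt:n$ and $\Gamma\vdash\pi^mt:(m,n)$; $\Gamma\vdash t:n$, $\Delta\vdash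 r:m\Rightarrow\Gamma,\Delta\vdash t\otimes r:n+m$; $\Gamma\vdash(b^m,\rho^n):(m,n)$; $x:n\vdash t_i:A$ (all $i$), $\Gamma\vdash r:(m,n)\Rightarrow\Gamma\vdash\mathsf{letcase}\ x=r\ \mathsf{in}\ \{t_0,\dots\}:A$. Typing $\Vdash$ for $\lambda_\rho^\circ$: the same rules (with $\mathsf{letcase}^\circ$) without the rule for $(b^m,\rho^n)$, plus: $\Gamma\Vdash t_i:A$ for all $i$ and $\sum_ip_i=1$ $\Rightarrow\Gamma\Vdash\sum_ip_it_i:A$. Reduction $\to_p$ of $\lambda_\rho$: $(\lambda x.t)r\to_1t[r/x]$; $U^m\rho^n\to_1\overline{U^m}\rho^n\overline{U^m}^\dagger$; $\pi^m\rho^n\to_{p_i}(i,\rho^n_i)$ with $p_i=\mathrm{tr}(\overline{\pi_i}^\dagger\overline{\pi_i}\rho^n)$, $\rho^n_i=\overline{\pi_i}\rho^n\overline{\pi_i}^\dagger/p_i$; $\rho\otimes\rho'\to_1$ the matrix $\rho\otimes\rho'$; $\mathsf{letcase}\ x=(b^m,\rho^n)\ \mathsf{in}\ \{t_0,\dots\}\to_1t_{b^m}[\rho^n/x]$; closed under the contexts $\lambda x.[\,]$, $[\,]s$, $s[\,]$, $U^n[\,]$, $\pi^n[\,]$, $[\,]\otimes s$, $s\otimes[\,]$ and the scrutinee of $\mathsf{letcase}$. Reduction $\to^\circ$ of $\lambda_\rho^\circ$: $(\lambda x.t)r\to^\circ t[r/x]$; $\mathsf{letcase}^\circ\ x=\pi^m\rho^n\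 \mathsf{in}\ \{t_0,\dots\}\to^\circ\sum_ip_it_i[\rho^n_i/x]$ (same $p_i,\rho^n_i$); $U^m\rho^n\to^\circ\overline{U^m}\rho^n\overline{U^m}^\dagger$; $\rho\otimes\rho'\to^\circ\rho\otimes\rho'$; $\sum_ip_i\rho_i\to^\circ$ the matrix $\sum_ip_i\rho_i$; $\sum_ip_it\to^\circ t$; $(\sum_ip_it_i)r\to^\circ\sum_ip_i(t_ir)$; closed under the same contexts (with $\mathsf{letcase}^\circ$) and under rewriting one summand of a sum. *)

theory Defs
  imports
    "HOL-Library.Multiset"
    "Jordan_Normal_Form.Schur_Decomposition"
begin

section \<open>Matrices\<close>

definition kron :: "complex mat \<Rightarrow> complex mat \<Rightarrow> complex mat" (infixl \<open>\<otimes>\<^sub>m\<close> 70) where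
  "A \<otimes>\<^sub>m B = mat (dim_row A * dim_row B) (dim_col A * dim_col B)
     (\<lambda>(i, j). A $$ (i div dim_row B, j div dim_col B) * B $$ (i mod dim_row B, j mod dim_col B))"

definition mat_trace :: "complex mat \<Rightarrow> complex" where
  "mat_trace A = (\<Sum>i<dim_row A. A $$ (i, i))"

definition density :: "nat \<Rightarrow> complex mat \<Rightarrow> bool" where
  "density n \<rho> \<longleftrightarrow> \<rho> \<in> carrier_mat (2 ^ n) (2 ^ n) \<and> mat_adjoint \<rho> = \<rho> \<and>
     (\<forall>v \<in> carrier_vec (2 ^ n). 0 \<le> Re ((\<rho> *\<^sub>v v) \<bullet>c v)) \<and> mat_trace \<rho> = 1"

definition unitary :: "nat \<Rightarrow> complex mat \<Rightarrow> bool" where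
  "unitary n U \<longleftrightarrow> U \<in> carrier_mat (2 ^ n) (2 ^ n) \<and>
     mat_adjoint U * U = 1\<^sub>m (2 ^ n) \<and> U * mat_adjoint U = 1\<^sub>m (2 ^ n)"

text \<open>The extension \<open>A \<otimes> I\<close> of an operator on the first \<open>m\<close> qubits to \<open>n\<close> qubits; it is meant
  only for \<open>m \<le> n\<close>.\<close>

definition lift_op :: "nat \<Rightarrow> nat \<Rightarrow> complex mat \<Rightarrow> complex mat" where
  "lift_op m n A = A \<otimes>\<^sub>m 1\<^sub>m (2 ^ (n - m))"

definition basis_proj :: "nat \<Rightarrow> nat \<Rightarrow> complex mat" where
  "basis_proj m i = mat (2 ^ m) (2 ^ m) (\<lambda>(j, k). if j = i \<and> k = i then 1 else 0)"

definition apply_unitary :: "nat \<Rightarrow> nat \<Rightarrow> complex mat \<Rightarrow> complex mat \<Rightarrow> complex mat" where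
  "apply_unitary m n U \<rho> = lift_op m n U * \<rho> * mat_adjoint (lift_op m n U)"

text \<open>The trace is a real number when \<open>\<rho>\<close> is a density matrix.\<close>

definition meas_prob :: "nat \<Rightarrow> nat \<Rightarrow> nat \<Rightarrow> complex mat \<Rightarrow> real" where
  "meas_prob m n i \<rho> =
     Re (mat_trace (mat_adjoint (lift_op m n (basis_proj m i)) * lift_op m n (basis_proj m i) * \<rho>))"

definition meas_state :: "nat \<Rightarrow> nat \<Rightarrow> nat \<Rightarrow> complex mat \<Rightarrow> complex mat" where
  "meas_state m n i \<rho> = complex_of_real (1 / meas_prob m n i \<rho>) \<cdot>\<^sub>m
     (lift_op m n (basis_proj m i) * \<rho> * mat_adjoint (lift_op m n (basis_proj m i)))"

definition mixture :: "nat \<Rightarrow> (real \<times> complex mat) multiset \<Rightarrow> complex mat" where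
  "mixture n M = mat (2 ^ n) (2 ^ n)
     (\<lambda>ij. \<Sum>(p, \<rho>)\<in>#M. complex_of_real p * \<rho> $$ ij)"


section \<open>Types and contexts\<close>

datatype ty = TQ nat | TM nat nat | TFun ty ty (infixr \<open>\<multimap>\<close> 60)

text \<open>Terms are taken up to \<open>\<alpha>\<close>-equivalence by means of de Bruijn indices, so a context is a partial
  map from indices to types. It is not a list: in \<open>\<Gamma>, \<Delta>\<close> the variables of one context are holes in
  the other, and \<open>\<Gamma>, \<Delta>\<close> is \<open>\<Gamma> ++ \<Delta>\<close> for disjoint domains.\<close>

type_synonym ctx = "nat \<rightharpoonup> ty"

text \<open>\<open>\<Gamma>, x : A\<close>, where \<open>x\<close> becomes index \<open>0\<close>.\<close>

definition ctx_cons :: "ty \<Rightarrow> ctx \<Rightarrow> ctx" where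
  "ctx_cons A \<Gamma> = (\<lambda>i. case i of 0 \<Rightarrow> Some A | Suc j \<Rightarrow> \<Gamma> j)"


section \<open>The calculus with probabilistic reduction\<close>

text \<open>The datatype contains more than the grammar: that \<open>\<rho>\<close> is a density matrix, that \<open>U\<close> is
  unitary, that \<open>b < 2 ^ m\<close>, and that a letcase has \<open>2 ^ m\<close> branches are premises of the typing
  rules, so that every typable element is a term of the calculus. Each branch of a letcase binds
  one variable.\<close>

datatype lterm =
    Var nat
  | Lam lterm
  | App lterm lterm
  | Rho nat "complex mat"
  | Uni nat "complex mat" lterm
  | Meas nat lterm
  | Tens lterm lterm
  | Res nat nat nat "complex mat"  \<comment> \<open>\<open>Res b m n \<rho>\<close> is \<open>(b\<^sup>m, \<rho>\<^sup>n)\<close>\<close>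
  | Letcase lterm "lterm list"

primrec shift :: "lterm \<Rightarrow> nat \<Rightarrow> lterm" where
  "shift (Var i) k = Var (if i < k then i else Suc i)"
| "shift (Lam t) k = Lam (shift t (Suc k))"
| "shift (App t u) k = App (shift t k) (shift u k)"
| "shift (Rho n \<rho>) k = Rho n \<rho>"
| "shift (Uni m U t) k = Uni m U (shift t k)"
| "shift (Meas m t) k = Meas m (shift t k)"
| "shift (Tens t u) k = Tens (shift t k) (shift u k)"
| "shift (Res b m n \<rho>) k = Res b m n \<rho>"
| "shift (Letcase t ts) k = Letcase (shift t k) (map (\<lambda>u. shift u (Suc k)) ts)"

text \<open>\<open>subst t s k\<close> is the capture-avoiding substitution of \<open>s\<close> for index \<open>k\<close> in \<open>t\<close>; indices above
  \<open>k\<close> decrease by one because the binder of \<open>k\<close> disappears.\<close>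

primrec subst :: "lterm \<Rightarrow> lterm \<Rightarrow> nat \<Rightarrow> lterm" where
  "subst (Var i) s k = (if i < k then Var i else if i = k then s else Var (i - 1))"
| "subst (Lam t) s k = Lam (subst t (shift s 0) (Suc k))"
| "subst (App t u) s k = App (subst t s k) (subst u s k)"
| "subst (Rho n \<rho>) s k = Rho n \<rho>"
| "subst (Uni m U t) s k = Uni m U (subst t s k)"
| "subst (Meas m t) s k = Meas m (subst t s k)"
| "subst (Tens t u) s k = Tens (subst t s k) (subst u s k)"
| "subst (Res b m n \<rho>) s k = Res b m n \<rho>"
| "subst (Letcase t ts) s k = Letcase (subst t s k) (map (\<lambda>u. subst u (shift s 0) (Suc k)) ts)"

text \<open>The axioms require the context to be finite, which makes all derivable contexts finite.\<close>

inductive typed :: "ctx \<Rightarrow> lterm \<Rightarrow> ty \<Rightarrow> bool" (\<open>_ \<turnstile> _ \<Colon> _\<close> [50, 50, 50] 50) where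
  var: "finite (dom \<Gamma>) \<Longrightarrow> \<Gamma> i = Some A \<Longrightarrow> \<Gamma> \<turnstile> Var i \<Colon> A"
| lam: "ctx_cons A \<Gamma> \<turnstile> t \<Colon> B \<Longrightarrow> \<Gamma> \<turnstile> Lam t \<Colon> A \<multimap> B"
| app: "\<Gamma> \<turnstile> t \<Colon> A \<multimap> B \<Longrightarrow> \<Delta> \<turnstile> r \<Colon> A \<Longrightarrow> dom \<Gamma> \<inter> dom \<Delta> = {} \<Longrightarrow>
    \<Gamma> ++ \<Delta> \<turnstile> App t r \<Colon> B"
| rho: "finite (dom \<Gamma>) \<Longrightarrow> density n \<rho> \<Longrightarrow> \<Gamma> \<turnstile> Rho n \<rho> \<Colon> TQ n"
| uni: "unitary m U \<Longrightarrow> \<Gamma> \<turnstile> t \<Colon> TQ n \<Longrightarrow> \<Gamma> \<turnstile> Uni m U t \<Colon> TQ n"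
| meas: "\<Gamma> \<turnstile> t \<Colon> TQ n \<Longrightarrow> \<Gamma> \<turnstile> Meas m t \<Colon> TM m n"
| tens: "\<Gamma> \<turnstile> t \<Colon> TQ n \<Longrightarrow> \<Delta> \<turnstile> r \<Colon> TQ m \<Longrightarrow> dom \<Gamma> \<inter> dom \<Delta> = {} \<Longrightarrow>
    \<Gamma> ++ \<Delta> \<turnstile> Tens t r \<Colon> TQ (n + m)"
| res: "finite (dom \<Gamma>) \<Longrightarrow> b < 2 ^ m \<Longrightarrow> density n \<rho> \<Longrightarrow> \<Gamma> \<turnstile> Res b m n \<rho> \<Colon> TM m n"
| letcase: "length ts = 2 ^ m \<Longrightarrow> (\<And>t. t \<in> set ts \<Longrightarrow> [0 \<mapsto> TQ n] \<turnstile> t \<Colon> A) \<Longrightarrow>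
    \<Gamma> \<turnstile> r \<Colon> TM m n \<Longrightarrow> \<Gamma> \<turnstile> Letcase r ts \<Colon> A"

text \<open>The premises \<open>m \<le> n\<close> are what makes \<open>A \<otimes> I\<close> defined, and a measurement outcome of
  probability \<open>0\<close> is excluded because its post-measurement state is undefined.\<close>

inductive red :: "lterm \<Rightarrow> real \<Rightarrow> lterm \<Rightarrow> bool" (\<open>_ \<rightarrow>\<^bsub>_\<^esub> _\<close> [51, 0, 51] 50) where
  r_beta: "App (Lam t) s \<rightarrow>\<^bsub>1\<^esub> subst t s 0"
| r_uni: "m \<le> n \<Longrightarrow> Uni m U (Rho n \<rho>) \<rightarrow>\<^bsub>1\<^esub> Rho n (apply_unitary m n U \<rho>)"
| r_meas: "m \<le> n \<Longrightarrow> i < 2 ^ m \<Longrightarrow> p = meas_prob m n i \<rho> \<Longrightarrow> 0 < p \<Longrightarrow>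
    Meas m (Rho n \<rho>) \<rightarrow>\<^bsub>p\<^esub> Res i m n (meas_state m n i \<rho>)"
| r_tens: "Tens (Rho n \<rho>) (Rho n' \<rho>') \<rightarrow>\<^bsub>1\<^esub> Rho (n + n') (\<rho> \<otimes>\<^sub>m \<rho>')"
| r_letcase: "length ts = 2 ^ m \<Longrightarrow> b < 2 ^ m \<Longrightarrow>
    Letcase (Res b m n \<rho>) ts \<rightarrow>\<^bsub>1\<^esub> subst (ts ! b) (Rho n \<rho>) 0"
| r_lam: "t \<rightarrow>\<^bsub>p\<^esub> t' \<Longrightarrow> Lam t \<rightarrow>\<^bsub>p\<^esub> Lam t'"
| r_app1: "t \<rightarrow>\<^bsub>p\<^esub> t' \<Longrightarrow> App t s \<rightarrow>\<^bsub>p\<^esub> App t' s"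
| r_app2: "t \<rightarrow>\<^bsub>p\<^esub> t' \<Longrightarrow> App s t \<rightarrow>\<^bsub>p\<^esub> App s t'"
| r_uni_ctx: "t \<rightarrow>\<^bsub>p\<^esub> t' \<Longrightarrow> Uni m U t \<rightarrow>\<^bsub>p\<^esub> Uni m U t'"
| r_meas_ctx: "t \<rightarrow>\<^bsub>p\<^esub> t' \<Longrightarrow> Meas m t \<rightarrow>\<^bsub>p\<^esub> Meas m t'"
| r_tens1: "t \<rightarrow>\<^bsub>p\<^esub> t' \<Longrightarrow> Tens t s \<rightarrow>\<^bsub>p\<^esub> Tens t' s"
| r_tens2: "t \<rightarrow>\<^bsub>p\<^esub> t' \<Longrightarrow> Tens s t \<rightarrow>\<^bsub>p\<^esub> Tens s t'"
| r_letcase_ctx: "t \<rightarrow>\<^bsub>p\<^esub> t' \<Longrightarrow> Letcase t ts \<rightarrow>\<^bsub>p\<^esub> Letcase t' ts"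


section \<open>The calculus with sums\<close>

text \<open>A sum modulo associativity and commutativity is a multiset of weighted terms. As for the first
  calculus, the grammar's conditions, here also \<open>p \<in> (0, 1]\<close> for all weights and total weight \<open>1\<close>,
  are premises of the typing rules.\<close>

datatype oterm =
    OVar nat
  | OLam oterm
  | OApp oterm oterm
  | ORho nat "complex mat"
  | OUni nat "complex mat" oterm
  | OMeas nat oterm
  | OTens oterm oterm
  | OLetcase oterm "oterm list"
  | OSum "(real \<times> oterm) multiset"

primrec oshift :: "oterm \<Rightarrow> nat \<Rightarrow> oterm" where
  "oshift (OVar i) k = OVar (if i < k then i else Suc i)"
| "oshift (OLam t) k = OLam (oshift t (Suc k))"
| "oshift (OApp t u) k = OApp (oshift t k) (oshift u k)"
| "oshift (ORho n \<rho>) k = ORho n \<rho>"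
| "oshift (OUni m U t) k = OUni m U (oshift t k)"
| "oshift (OMeas m t) k = OMeas m (oshift t k)"
| "oshift (OTens t u) k = OTens (oshift t k) (oshift u k)"
| "oshift (OLetcase t ts) k = OLetcase (oshift t k) (map (\<lambda>u. oshift u (Suc k)) ts)"
| "oshift (OSum M) k = OSum (image_mset (map_prod id (\<lambda>u. oshift u k)) M)"

primrec osubst :: "oterm \<Rightarrow> oterm \<Rightarrow> nat \<Rightarrow> oterm" where
  "osubst (OVar i) s k = (if i < k then OVar i else if i = k then s else OVar (i - 1))"
| "osubst (OLam t) s k = OLam (osubst t (oshift s 0) (Suc k))"
| "osubst (OApp t u) s k = OApp (osubst t s k) (osubst u s k)"
| "osubst (ORho n \<rho>) s k = ORho n \<rho>"
| "osubst (OUni m U t) s k = OUni m U (osubst t s k)"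
| "osubst (OMeas m t) s k = OMeas m (osubst t s k)"
| "osubst (OTens t u) s k = OTens (osubst t s k) (osubst u s k)"
| "osubst (OLetcase t ts) s k = OLetcase (osubst t s k) (map (\<lambda>u. osubst u (oshift s 0) (Suc k)) ts)"
| "osubst (OSum M) s k = OSum (image_mset (map_prod id (\<lambda>u. osubst u s k)) M)"

inductive otyped :: "ctx \<Rightarrow> oterm \<Rightarrow> ty \<Rightarrow> bool" (\<open>_ \<tturnstile> _ \<Colon> _\<close> [50, 50, 50] 50) where
  ovar: "finite (dom \<Gamma>) \<Longrightarrow> \<Gamma> i = Some A \<Longrightarrow> \<Gamma> \<tturnstile> OVar i \<Colon> A"
| olam: "ctx_cons A \<Gamma> \<tturnstile> t \<Colon> B \<Longrightarrow> \<Gamma> \<tturnstile> OLam t \<Colon> A \<multimap> B"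
| oapp: "\<Gamma> \<tturnstile> t \<Colon> A \<multimap> B \<Longrightarrow> \<Delta> \<tturnstile> r \<Colon> A \<Longrightarrow> dom \<Gamma> \<inter> dom \<Delta> = {} \<Longrightarrow>
    \<Gamma> ++ \<Delta> \<tturnstile> OApp t r \<Colon> B"
| orho: "finite (dom \<Gamma>) \<Longrightarrow> density n \<rho> \<Longrightarrow> \<Gamma> \<tturnstile> ORho n \<rho> \<Colon> TQ n"
| ouni: "unitary m U \<Longrightarrow> \<Gamma> \<tturnstile> t \<Colon> TQ n \<Longrightarrow> \<Gamma> \<tturnstile> OUni m U t \<Colon> TQ n"
| omeas: "\<Gamma> \<tturnstile> t \<Colon> TQ n \<Longrightarrow> \<Gamma> \<tturnstile> OMeas m t \<Colon> TM m n"
| otens: "\<Gamma> \<tturnstile> t \<Colon> TQ n \<Longrightarrow> \<Delta> \<tturnstile> r \<Colon> TQ m \<Longrightarrow> dom \<Gamma> \<inter> dom \<Delta> = {} \<Longrightarrow>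
    \<Gamma> ++ \<Delta> \<tturnstile> OTens t r \<Colon> TQ (n + m)"
| oletcase: "length ts = 2 ^ m \<Longrightarrow> (\<And>t. t \<in> set ts \<Longrightarrow> [0 \<mapsto> TQ n] \<tturnstile> t \<Colon> A) \<Longrightarrow>
    \<Gamma> \<tturnstile> r \<Colon> TM m n \<Longrightarrow> \<Gamma> \<tturnstile> OLetcase r ts \<Colon> A"
| osum: "(\<And>p t. (p, t) \<in># M \<Longrightarrow> 0 < p \<and> p \<le> 1) \<Longrightarrow> (\<Sum>(p, t)\<in>#M. p) = 1 \<Longrightarrow>
    (\<And>p t. (p, t) \<in># M \<Longrightarrow> \<Gamma> \<tturnstile> t \<Colon> A) \<Longrightarrow> \<Gamma> \<tturnstile> OSum M \<Colon> A"

inductive ored :: "oterm \<Rightarrow> oterm \<Rightarrow> bool" (infix \<open>\<rightarrow>\<^sup>\<circ>\<close> 50) where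
  or_beta: "OApp (OLam t) s \<rightarrow>\<^sup>\<circ> osubst t s 0"
| or_uni: "m \<le> n \<Longrightarrow> OUni m U (ORho n \<rho>) \<rightarrow>\<^sup>\<circ> ORho n (apply_unitary m n U \<rho>)"
| or_letcase: "m \<le> n \<Longrightarrow> length ts = 2 ^ m \<Longrightarrow>
    OLetcase (OMeas m (ORho n \<rho>)) ts \<rightarrow>\<^sup>\<circ>
      OSum {#(meas_prob m n i \<rho>, osubst (ts ! i) (ORho n (meas_state m n i \<rho>)) 0).
        i \<in># mset_set {i. i < 2 ^ m \<and> 0 < meas_prob m n i \<rho>}#}"
| or_tens: "OTens (ORho n \<rho>) (ORho n' \<rho>') \<rightarrow>\<^sup>\<circ> ORho (n + n') (\<rho> \<otimes>\<^sub>m \<rho>')"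
| or_mix: "OSum {#(p, ORho n \<rho>). (p, \<rho>) \<in># M#} \<rightarrow>\<^sup>\<circ> ORho n (mixture n M)"
| or_idem: "M \<noteq> {#} \<Longrightarrow> OSum {#(p, t). p \<in># M#} \<rightarrow>\<^sup>\<circ> t"
| or_app_sum: "OApp (OSum M) s \<rightarrow>\<^sup>\<circ> OSum {#(p, OApp t s). (p, t) \<in># M#}"
| or_lam: "t \<rightarrow>\<^sup>\<circ> t' \<Longrightarrow> OLam t \<rightarrow>\<^sup>\<circ> OLam t'"
| or_app1: "t \<rightarrow>\<^sup>\<circ> t' \<Longrightarrow> OApp t s \<rightarrow>\<^sup>\<circ> OApp t' s"
| or_app2: "t \<rightarrow>\<^sup>\<circ> t' \<Longrightarrow> OApp s t \<rightarrow>\<^sup>\<circ> OApp s t'"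
| or_uni_ctx: "t \<rightarrow>\<^sup>\<circ> t' \<Longrightarrow> OUni m U t \<rightarrow>\<^sup>\<circ> OUni m U t'"
| or_meas_ctx: "t \<rightarrow>\<^sup>\<circ> t' \<Longrightarrow> OMeas m t \<rightarrow>\<^sup>\<circ> OMeas m t'"
| or_tens1: "t \<rightarrow>\<^sup>\<circ> t' \<Longrightarrow> OTens t s \<rightarrow>\<^sup>\<circ> OTens t' s"
| or_tens2: "t \<rightarrow>\<^sup>\<circ> t' \<Longrightarrow> OTens s t \<rightarrow>\<^sup>\<circ> OTens s t'"
| or_letcase_ctx: "t \<rightarrow>\<^sup>\<circ> t' \<Longrightarrow> OLetcase t ts \<rightarrow>\<^sup>\<circ> OLetcase t' ts"
| or_sum_ctx: "t \<rightarrow>\<^sup>\<circ> t' \<Longrightarrow> OSum (add_mset (p, t) M) \<rightarrow>\<^sup>\<circ> OSum (add_mset (p, t') M)"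

end

theory Submission
  imports Defs
begin

text \<open>Both parts are inductions on the reduction. A \<open>\<beta>\<close>- or letcase-redex is handled by a substitution
  lemma for affine contexts. The other redexes need that the matrix produced is again a
  density matrix. This holds for conjugation by any operator up to the trace, which unitarity or
  the division by the outcome probability restores, and for convex combinations. For
  \<open>\<rho> \<otimes> \<sigma>\<close> one factors \<open>\<rho>\<close> as a sum of rank-one matrices \<open>w w\<^sup>\<dagger>\<close>, so that \<open>\<rho> \<otimes> \<sigma>\<close> is a sum of
  conjugates of \<open>\<sigma>\<close>. The measurement probabilities of a density matrix are nonnegative and sum to
  the trace, so dropping the impossible outcomes leaves a sum of total weight \<open>1\<close>.\<close>

section \<open>Positive semidefinite kernels\<close>

text \<open>An index below \<open>m * n\<close> is a pair of quotient and remainder, with inverse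
  \<open>i * n + j\<close>. Sums over Kronecker product indices are split this way.\<close>

lemma sum_lessThan_prod:
  fixes f :: "nat \<Rightarrow> nat \<Rightarrow> 'a::comm_monoid_add"
  shows "(\<Sum>i<m * n. f (i div n) (i mod n)) = (\<Sum>i<m. \<Sum>j<n. f i j)"
proof -
  have "(\<Sum>i<m * n. f (i div n) (i mod n)) = (\<Sum>(i, j)\<in>{..<m} \<times> {..<n}. f i j)"
  proof (rule sum.reindex_bij_witness[where i = "\<lambda>(i, j). i * n + j" and j = "\<lambda>i. (i div n, i mod n)"])
    fix a assume a: "a \<in> {..<m} \<times> {..<n}"
    then obtain i j where ij: "a = (i, j)" "i < m" "j < n" by auto
    have "i * n + j < Suc i * n" using ij by simp
    also have "\<dots> \<le> m * n" using ij by (intro mult_right_mono) auto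
    finally show "(case a of (i, j) \<Rightarrow> i * n + j) \<in> {..<m * n}" using ij by simp
    show "((case a of (i, j) \<Rightarrow> i * n + j) div n, (case a of (i, j) \<Rightarrow> i * n + j) mod n) = a"
      using ij by simp
  next
    fix a assume "a \<in> {..<m * n}"
    then show "(a div n, a mod n) \<in> {..<m} \<times> {..<n}"
      by (cases "n = 0") (auto simp: less_mult_imp_div_less)
  qed auto
  then show ?thesis by (simp add: sum.cartesian_product)
qed

text \<open>The form x\<dagger> a x. Kernels are functions on indices, not matrices, so that
  lowering the dimension from \<open>Suc n\<close> to \<open>n\<close> and regrouping indices by
  \<open>div\<close> and \<open>mod\<close> need no block matrices.\<close>

definition herm_form :: "nat \<Rightarrow> (nat \<Rightarrow> nat \<Rightarrow> complex) \<Rightarrow> (nat \<Rightarrow> complex) \<Rightarrow> complex" where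
  "herm_form n a x = (\<Sum>i<n. \<Sum>j<n. a i j * x j * cnj (x i))"

text \<open>Only entries and coordinates below \<open>n\<close> count, so \<open>x\<close> may range
  over all functions.\<close>

definition psd :: "nat \<Rightarrow> (nat \<Rightarrow> nat \<Rightarrow> complex) \<Rightarrow> bool" where
  "psd n a \<longleftrightarrow> (\<forall>i<n. \<forall>j<n. cnj (a i j) = a j i) \<and> (\<forall>x. 0 \<le> Re (herm_form n a x))"

lemma psd_cong: "(\<And>i j. i < n \<Longrightarrow> j < n \<Longrightarrow> a i j = b i j) \<Longrightarrow> psd n a \<longleftrightarrow> psd n b"
  by (simp add: psd_def herm_form_def)

lemma psd_diag:
  assumes "psd n a" "i < n"
  shows "a i i = complex_of_real (Re (a i i))" "0 \<le> Re (a i i)"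
proof -
  have "cnj (a i i) = a i i" using assms by (simp add: psd_def)
  then show "a i i = complex_of_real (Re (a i i))" by (simp add: complex_eq_iff)
  have "herm_form n a (\<lambda>j. if j = i then 1 else 0) =
      (\<Sum>k<n. \<Sum>j<n. if j = i then (if k = i then a k j else 0) else 0)"
    unfolding herm_form_def by (intro sum.cong) auto
  also have "\<dots> = a i i" using assms(2) by simp
  finally show "0 \<le> Re (a i i)" using assms(1) by (metis psd_def)
qed

lemma herm_form_Suc:
  "herm_form (Suc n) a x = herm_form n a x + (\<Sum>j<n. a n j * x j) * cnj (x n)
     + (\<Sum>i<n. a i n * cnj (x i)) * x n + a n n * (x n * cnj (x n))"
  by (simp add: herm_form_def sum.distrib sum_distrib_left sum_distrib_right algebra_simps)

lemma herm_form_cong: "(\<And>i. i < n \<Longrightarrow> x i = y i) \<Longrightarrow> herm_form n a x = herm_form n a y"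
  by (simp add: herm_form_def)

text \<open>With corner 0 the form has no quadratic term in the last coordinate; a nonzero
  \<open>a i n\<close> would leave a linear term there, and the form would become negative.\<close>

lemma psd_zero_diag:
  assumes "psd (Suc n) a" "a n n = 0" "i < n"
  shows "a i n = 0"
proof (rule ccontr)
  assume nz: "a i n \<noteq> 0"
  \<comment> \<open>At the vector \<open>x\<close> below the form has real part
    \<open>Re (a i i) - 2 * s * (cmod (a i n))\<^sup>2\<close>; this \<open>s\<close> makes it
    -1.\<close>
  define s where "s = (Re (a i i) + 1) / (2 * (cmod (a i n))\<^sup>2)"
  define x where "x j = (if j = i then 1 else if j = n then - complex_of_real s * cnj (a i n) else 0)" for j
  have h: "a n i = cnj (a i n)" using assms by (simp add: psd_def del: complex_cnj_cancel_iff)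
  have "herm_form n a x = (\<Sum>k<n. \<Sum>j<n. if j = i then (if k = i then a k j else 0) else 0)"
    unfolding herm_form_def x_def by (intro sum.cong) auto
  also have "\<dots> = a i i" using assms(3) by simp
  finally have 1: "herm_form n a x = a i i" .
  have "(\<Sum>j<n. a n j * x j) = (\<Sum>j<n. if j = i then a n j else 0)"
    unfolding x_def by (intro sum.cong) auto
  then have 2: "(\<Sum>j<n. a n j * x j) = a n i" using assms(3) by simp
  have "(\<Sum>j<n. a j n * cnj (x j)) = (\<Sum>j<n. if j = i then a j n else 0)"
    unfolding x_def by (intro sum.cong) auto
  then have 3: "(\<Sum>j<n. a j n * cnj (x j)) = a i n" using assms(3) by simp
  have xn: "x n = - complex_of_real s * cnj (a i n)" using assms(3) by (simp add: x_def)
  have "herm_form (Suc n) a x = a i i - 2 * complex_of_real s * (a i n * cnj (a i n))"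
    unfolding herm_form_Suc 1 2 3 h xn using assms(2) by (simp add: algebra_simps)
  also have "\<dots> = a i i - complex_of_real (2 * s * (cmod (a i n))\<^sup>2)"
    by (simp add: complex_norm_square[symmetric])
  finally have "Re (herm_form (Suc n) a x) = Re (a i i) - 2 * s * (cmod (a i n))\<^sup>2" by simp
  also have "2 * s * (cmod (a i n))\<^sup>2 = Re (a i i) + 1" using nz by (simp add: s_def)
  also have "Re (a i i) - (Re (a i i) + 1) = -1" by simp
  finally show False using assms(1) by (metis psd_def neg_0_le_iff_le not_one_le_zero)
qed

text \<open>A Cholesky step: subtracting the rank-one kernel of the last column leaves the
  Schur complement, whose form at \<open>x\<close> is the original one at \<open>x\<close> extended by the minimizing
  last coordinate. If the last diagonal entry is \<open>0\<close>, so is its column, and the division by \<open>0\<close> makes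
  the step trivial.\<close>

lemma psd_factor:
  assumes "psd n a"
  shows "\<exists>w. \<forall>i<n. \<forall>j<n. a i j = (\<Sum>k<n. w k i * cnj (w k j))"
  using assms
proof (induction n arbitrary: a)
  case 0
  then show ?case by simp
next
  case (Suc n)
  define d where "d = Re (a n n)"
  have d: "a n n = complex_of_real d" "0 \<le> d"
    using psd_diag[OF Suc.prems, of n] by (simp_all add: d_def)
  have h: "cnj (a i j) = a j i" if "i \<le> n" "j \<le> n" for i j
    using Suc.prems that by (simp add: psd_def)
  define v where "v i = a i n / complex_of_real (sqrt d)" for i
  have v: "v i * cnj (v j) = a i n * a n j / complex_of_real d" if "j \<le> n" for i j
  proof -
    have "complex_of_real (sqrt d) * complex_of_real (sqrt d) = complex_of_real d"
      using d(2) by (simp flip: of_real_mult)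
    then show ?thesis using h[of j n] that by (simp add: v_def)
  qed
  define b where "b i j = a i j - v i * cnj (v j)" for i j
  \<comment> \<open>Since \<open>b\<close> vanishes on its last row and column, a factorization of
    its leading block extends by zeros.\<close>
  have edge: "b i j = 0" if "i \<le> n" "j \<le> n" "i = n \<or> j = n" for i j
  proof (cases "d = 0")
    case True
    then have "a i n = 0" if "i \<le> n" for i
      using psd_zero_diag[OF Suc.prems, of i] d that by (cases "i = n") auto
    then show ?thesis using that h[of i j] h[of j n] v[of j i] by (auto simp: b_def)
  next
    case False
    then show ?thesis using that v[of j i] d by (auto simp: b_def)
  qed
  have "psd n b"
    unfolding psd_def
  proof (intro conjI allI impI)
    fix i j assume "i < n" "j < n"
    then show "cnj (b i j) = b j i" using h[of i j] by (simp add: b_def)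
  next
    fix x :: "nat \<Rightarrow> complex"
    define S where "S = (\<Sum>j<n. a n j * x j)"
    have S: "(\<Sum>i<n. a i n * cnj (x i)) = cnj S"
      using h[of n] by (auto simp: S_def intro!: sum.cong)
    define y where "y = x(n := - S / complex_of_real d)"
    have "herm_form n b x = herm_form n a x - (\<Sum>i<n. \<Sum>j<n. (a i n * cnj (x i)) * (a n j * x j)) / complex_of_real d"
      unfolding herm_form_def sum_divide_distrib sum_subtractf[symmetric] b_def
      by (intro sum.cong refl) (simp add: v algebra_simps diff_divide_distrib)
    also have "\<dots> = herm_form n a x - cnj S * S / complex_of_real d"
      by (simp add: sum_product[symmetric] S S_def[symmetric])
    also have "\<dots> = herm_form (Suc n) a y"
    proof -
      have "herm_form n a y = herm_form n a x" by (rule herm_form_cong) (simp add: y_def)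
      moreover have "(\<Sum>j<n. a n j * y j) = S" "(\<Sum>i<n. a i n * cnj (y i)) = cnj S"
        by (simp_all add: S[symmetric] y_def) (simp add: S_def)
      ultimately show ?thesis
        unfolding herm_form_Suc by (cases "d = 0") (simp_all add: y_def d field_simps)
    qed
    finally show "0 \<le> Re (herm_form n b x)" using Suc.prems by (simp add: psd_def)
  qed
  then obtain w where w: "\<forall>i<n. \<forall>j<n. b i j = (\<Sum>k<n. w k i * cnj (w k j))"
    using Suc.IH by blast
  \<comment> \<open>The vectors factoring \<open>b\<close> get the coordinate 0 at \<open>n\<close>,
    and \<open>v\<close> joins them as vector number \<open>n\<close>.\<close>
  define w' where "w' k i = (if k = n then v i else if i = n then 0 else w k i)" for k i
  have "a i j = (\<Sum>k<Suc n. w' k i * cnj (w' k j))" if "i < Suc n" "j < Suc n" for i j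
  proof -
    have "(\<Sum>k<n. w' k i * cnj (w' k j)) = b i j"
      using that w edge[of i j] by (cases "i = n \<or> j = n") (auto simp: w'_def)
    then show ?thesis by (simp add: b_def w'_def)
  qed
  then show ?case by blast
qed

text \<open>The kernel is that of C a C\<dagger> for a possibly rectangular C, and its form at x is
  the form of \<open>a\<close> at C\<dagger> x, which is \<open>y\<close> in the proof.\<close>

lemma psd_conj:
  assumes "psd n a"
  shows "psd m (\<lambda>i j. \<Sum>k<n. \<Sum>l<n. c i k * a k l * cnj (c j l))"
  unfolding psd_def
proof (intro conjI allI impI)
  fix i j
  have "cnj (\<Sum>k<n. \<Sum>l<n. c i k * a k l * cnj (c j l)) = (\<Sum>k<n. \<Sum>l<n. c j l * a l k * cnj (c i k))"
    using assms unfolding cnj_sum by (intro sum.cong refl) (simp add: psd_def)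
  also have "\<dots> = (\<Sum>k<n. \<Sum>l<n. c j k * a k l * cnj (c i l))"
    by (rule sum.swap)
  finally show "cnj (\<Sum>k<n. \<Sum>l<n. c i k * a k l * cnj (c j l)) = (\<Sum>k<n. \<Sum>l<n. c j k * a k l * cnj (c i l))" .
next
  fix x
  define y where "y l = (\<Sum>j<m. cnj (c j l) * x j)" for l
  define f where "f i j k l = a k l * (cnj (c j l) * x j) * cnj (cnj (c i k) * x i)" for i j k l
  have "herm_form m (\<lambda>i j. \<Sum>k<n. \<Sum>l<n. c i k * a k l * cnj (c j l)) x
      = (\<Sum>i<m. \<Sum>j<m. \<Sum>k<n. \<Sum>l<n. f i j k l)"
    unfolding herm_form_def sum_distrib_right by (simp add: f_def mult_ac)
  also have "\<dots> = (\<Sum>k<n. \<Sum>l<n. \<Sum>i<m. \<Sum>j<m. f i j k l)"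
    \<comment> \<open>Fixing the two ranges orients the swap: unfolding it exhaustively pulls the
      sums over \<open>{..<n}\<close> outwards.\<close>
    unfolding sum.swap[of _ "{..<n}" "{..<m}"] ..
  also have "\<dots> = herm_form n a y"
    unfolding herm_form_def
  proof (intro sum.cong refl)
    fix k l
    have "(\<Sum>i<m. \<Sum>j<m. f i j k l) = a k l * ((\<Sum>i<m. cnj (cnj (c i k) * x i)) * y l)"
      unfolding y_def sum_product unfolding sum_distrib_left by (simp add: f_def mult_ac)
    then show "(\<Sum>i<m. \<Sum>j<m. f i j k l) = a k l * y l * cnj (y k)"
      by (simp add: y_def[of k])
  qed
  finally show "0 \<le> Re (herm_form m (\<lambda>i j. \<Sum>k<n. \<Sum>l<n. c i k * a k l * cnj (c j l)) x)"
    using assms by (simp add: psd_def)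
qed

section \<open>Nonnegative combinations and Kronecker products of kernels\<close>

lemma psd_zero: "psd n (\<lambda>i j. 0)"
  by (simp add: psd_def herm_form_def)

lemma psd_add: "psd n a \<Longrightarrow> psd n b \<Longrightarrow> psd n (\<lambda>i j. a i j + b i j)"
  by (simp add: psd_def herm_form_def distrib_right sum.distrib)

lemma psd_scale:
  assumes "psd n a" "0 \<le> r"
  shows "psd n (\<lambda>i j. complex_of_real r * a i j)"
proof -
  have "herm_form n (\<lambda>i j. complex_of_real r * a i j) x = complex_of_real r * herm_form n a x" for x
    by (simp add: herm_form_def sum_distrib_left mult.assoc)
  then show ?thesis using assms by (simp add: psd_def)
qed

lemma psd_sum: "finite K \<Longrightarrow> (\<And>k. k \<in> K \<Longrightarrow> psd n (a k)) \<Longrightarrow> psd n (\<lambda>i j. \<Sum>k\<in>K. a k i j)"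
  by (induction K rule: finite_induct) (simp_all add: psd_zero psd_add)

lemma psd_kron:
  assumes "psd n a" "psd m b"
  shows "psd (n * m) (\<lambda>i j. a (i div m) (j div m) * b (i mod m) (j mod m))"
proof -
  obtain w where w: "\<And>i j. i < n \<Longrightarrow> j < n \<Longrightarrow> a i j = (\<Sum>k<n. w k i * cnj (w k j))"
    using psd_factor[OF assms(1)] by blast
  \<comment> \<open>\<open>c k\<close> is the column \<open>w k\<close> tensored with the identity:
    it has \<open>n * m\<close> rows and \<open>m\<close> columns, and conjugating \<open>b\<close>
    by it gives the Kronecker product of the rank-one kernel of \<open>w k\<close> with
    \<open>b\<close>.\<close>
  define c where "c k i l = (if l = i mod m then w k (i div m) else 0)" for k i l
  have "psd (n * m) (\<lambda>i j. \<Sum>k<n. \<Sum>k'<m. \<Sum>l<m. c k i k' * b k' l * cnj (c k j l))"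
    by (intro psd_sum psd_conj assms) simp
  moreover have "(\<Sum>k<n. \<Sum>k'<m. \<Sum>l<m. c k i k' * b k' l * cnj (c k j l))
      = a (i div m) (j div m) * b (i mod m) (j mod m)" if ij: "i < n * m" "j < n * m" for i j
  proof -
    have m: "m > 0" using ij by (cases m) auto
    have "(\<Sum>k'<m. \<Sum>l<m. c k i k' * b k' l * cnj (c k j l))
        = w k (i div m) * cnj (w k (j div m)) * b (i mod m) (j mod m)" for k
    proof -
      have "(\<Sum>k'<m. \<Sum>l<m. c k i k' * b k' l * cnj (c k j l))
          = (\<Sum>k'<m. \<Sum>l<m. if l = j mod m then (if k' = i mod m
              then w k (i div m) * b k' l * cnj (w k (j div m)) else 0) else 0)"
        by (intro sum.cong refl) (simp add: c_def)
      then show ?thesis using m by (simp add: algebra_simps)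
    qed
    then show ?thesis
      using ij by (simp add: w less_mult_imp_div_less sum_distrib_right)
  qed
  ultimately show ?thesis by (simp cong: psd_cong)
qed

section \<open>Density matrices\<close>

lemma mat_adjoint_dim [simp]:
  "dim_row (mat_adjoint A) = dim_col A" "dim_col (mat_adjoint A) = dim_row A"
  by (simp_all add: mat_adjoint_def)

lemma mat_adjoint_carrier [simp]: "A \<in> carrier_mat n m \<Longrightarrow> mat_adjoint A \<in> carrier_mat m n"
  by (intro carrier_matI) auto

lemma mat_adjoint_index [simp]:
  fixes A :: "complex mat"
  assumes "i < dim_col A" "j < dim_row A"
  shows "mat_adjoint A $$ (i, j) = cnj (A $$ (j, i))"
  using assms by (simp add: mat_adjoint_def mat_of_rows_index)

lemma mult_mat_index:
  assumes "A \<in> carrier_mat n m" "B \<in> carrier_mat m l" "i < n" "j < l"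
  shows "(A * B) $$ (i, j) = (\<Sum>k<m. A $$ (i, k) * B $$ (k, j))"
  using assms by (simp add: scalar_prod_def lessThan_atLeast0)

lemma mat_trace_mult:
  assumes "A \<in> carrier_mat n m" "B \<in> carrier_mat m n"
  shows "mat_trace (A * B) = (\<Sum>i<n. \<Sum>k<m. A $$ (i, k) * B $$ (k, i))"
proof -
  have "dim_row (A * B) = n" using assms by simp
  then show ?thesis
    unfolding mat_trace_def by (intro sum.cong) (simp_all add: mult_mat_index[OF assms])
qed

lemma mat_trace_comm:
  assumes "A \<in> carrier_mat n m" "B \<in> carrier_mat m n"
  shows "mat_trace (A * B) = mat_trace (B * A)"
  unfolding mat_trace_mult[OF assms] mat_trace_mult[OF assms(2,1)]
  by (subst sum.swap) (simp add: mult.commute)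

text \<open>Bridge from matrices and vectors to kernels. A function \<open>x\<close> is truncated to
  \<open>vec (2 ^ n) x\<close>, which the form cannot distinguish from \<open>x\<close>.\<close>

lemma density_iff:
  "density n \<rho> \<longleftrightarrow>
    \<rho> \<in> carrier_mat (2 ^ n) (2 ^ n) \<and> psd (2 ^ n) (\<lambda>i j. \<rho> $$ (i, j)) \<and> mat_trace \<rho> = 1"
proof (cases "\<rho> \<in> carrier_mat (2 ^ n) (2 ^ n)")
  case True
  let ?N = "2 ^ n :: nat"
  have form: "(\<rho> *\<^sub>v v) \<bullet>c v = herm_form ?N (\<lambda>i j. \<rho> $$ (i, j)) (\<lambda>i. v $ i)"
    if "v \<in> carrier_vec ?N" for v
    using True that unfolding herm_form_def
    by (auto simp: scalar_prod_def lessThan_atLeast0 sum_distrib_right intro!: sum.cong)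
  have "(\<forall>v \<in> carrier_vec ?N. 0 \<le> Re ((\<rho> *\<^sub>v v) \<bullet>c v)) \<longleftrightarrow>
      (\<forall>x. 0 \<le> Re (herm_form ?N (\<lambda>i j. \<rho> $$ (i, j)) x))"
  proof (intro iffI allI ballI)
    fix x assume "\<forall>v \<in> carrier_vec ?N. 0 \<le> Re ((\<rho> *\<^sub>v v) \<bullet>c v)"
    then have "0 \<le> Re (herm_form ?N (\<lambda>i j. \<rho> $$ (i, j)) (\<lambda>i. vec ?N x $ i))"
      using form[of "vec ?N x"] by (metis vec_carrier)
    also have "herm_form ?N (\<lambda>i j. \<rho> $$ (i, j)) (\<lambda>i. vec ?N x $ i) = herm_form ?N (\<lambda>i j. \<rho> $$ (i, j)) x"
      by (rule herm_form_cong) simp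
    finally show "0 \<le> Re (herm_form ?N (\<lambda>i j. \<rho> $$ (i, j)) x)" .
  qed (simp add: form)
  moreover have "mat_adjoint \<rho> = \<rho> \<longleftrightarrow> (\<forall>i<?N. \<forall>j<?N. cnj (\<rho> $$ (i, j)) = \<rho> $$ (j, i))"
  proof
    assume "mat_adjoint \<rho> = \<rho>"
    then show "\<forall>i<?N. \<forall>j<?N. cnj (\<rho> $$ (i, j)) = \<rho> $$ (j, i)"
      using True mat_adjoint_index[of _ \<rho>] by (metis carrier_matD)
  qed (use True in \<open>auto intro!: eq_matI\<close>)
  ultimately show ?thesis using True by (simp add: density_def psd_def)
qed (simp add: density_def)

lemma psd_mat_conj:
  assumes "C \<in> carrier_mat n n" "\<rho> \<in> carrier_mat n n" "psd n (\<lambda>i j. \<rho> $$ (i, j))"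
  shows "psd n (\<lambda>i j. (C * \<rho> * mat_adjoint C) $$ (i, j))"
proof -
  have "(C * \<rho> * mat_adjoint C) $$ (i, j)
      = (\<Sum>k<n. \<Sum>l<n. C $$ (i, k) * \<rho> $$ (k, l) * cnj (C $$ (j, l)))" if "i < n" "j < n" for i j
  proof -
    have "(C * \<rho> * mat_adjoint C) $$ (i, j)
        = (\<Sum>l<n. \<Sum>k<n. C $$ (i, k) * \<rho> $$ (k, l) * cnj (C $$ (j, l)))"
      using assms that
      by (simp add: mult_mat_index[of _ n n _ n] sum_distrib_right del: index_mult_mat(1))
    also have "\<dots> = (\<Sum>k<n. \<Sum>l<n. C $$ (i, k) * \<rho> $$ (k, l) * cnj (C $$ (j, l)))"
      by (rule sum.swap)
    finally show ?thesis .
  qed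
  then show ?thesis
    using psd_conj[OF assms(3), of n "\<lambda>i k. C $$ (i, k)"] by (simp cong: psd_cong)
qed

text \<open>Cyclicity of the trace. The factor \<open>mat_adjoint C * C\<close> becomes the identity
  for a unitary, and for a projection the right-hand trace is the outcome probability.\<close>

lemma mat_trace_conj:
  assumes "C \<in> carrier_mat n n" "\<rho> \<in> carrier_mat n n"
  shows "mat_trace (C * \<rho> * mat_adjoint C) = mat_trace (mat_adjoint C * C * \<rho>)"
  using assms mat_trace_comm[of "C * \<rho>" n n "mat_adjoint C"] by (simp add: assoc_mult_mat[of _ n n _ n _ n])

section \<open>Kronecker products and operators on the first qubits\<close>

lemma kron_dim [simp]:
  "dim_row (A \<otimes>\<^sub>m B) = dim_row A * dim_row B" "dim_col (A \<otimes>\<^sub>m B) = dim_col A * dim_col B"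
  by (simp_all add: kron_def)

lemma kron_carrier:
  "A \<in> carrier_mat n m \<Longrightarrow> B \<in> carrier_mat k l \<Longrightarrow> A \<otimes>\<^sub>m B \<in> carrier_mat (n * k) (m * l)"
  by (intro carrier_matI) auto

lemma kron_index:
  assumes "A \<in> carrier_mat n m" "B \<in> carrier_mat k l" "i < n * k" "j < m * l"
  shows "(A \<otimes>\<^sub>m B) $$ (i, j) = A $$ (i div k, j div l) * B $$ (i mod k, j mod l)"
  using assms by (simp add: kron_def)

lemma div_mod_bounds:
  fixes i n k :: nat
  assumes "i < n * k"
  shows "i div k < n" "i mod k < k"
  using assms by (cases k; simp add: less_mult_imp_div_less)+

text \<open>The mixed-product rule: the summation index splits into a pair, and the double sum
  factors into two matrix products.\<close>

lemma kron_mult: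
  assumes "A \<in> carrier_mat n m" "B \<in> carrier_mat k l" "C \<in> carrier_mat m p" "D \<in> carrier_mat l q"
  shows "(A \<otimes>\<^sub>m B) * (C \<otimes>\<^sub>m D) = (A * C) \<otimes>\<^sub>m (B * D)"
proof (rule eq_matI)
  fix i j assume "i < dim_row ((A * C) \<otimes>\<^sub>m (B * D))" "j < dim_col ((A * C) \<otimes>\<^sub>m (B * D))"
  then have ij: "i < n * k" "j < p * q" using assms by auto
  note bounds = div_mod_bounds[OF ij(1)] div_mod_bounds[OF ij(2)]
  have "((A \<otimes>\<^sub>m B) * (C \<otimes>\<^sub>m D)) $$ (i, j) = (\<Sum>r<m * l.
      (A $$ (i div k, r div l) * B $$ (i mod k, r mod l)) * (C $$ (r div l, j div q) * D $$ (r mod l, j mod q)))"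
    unfolding mult_mat_index[OF kron_carrier[OF assms(1,2)] kron_carrier[OF assms(3,4)] ij]
    using ij by (intro sum.cong refl) (simp add: kron_index[OF assms(1,2)] kron_index[OF assms(3,4)])
  also have "\<dots> = (\<Sum>r<m. \<Sum>s<l.
      (A $$ (i div k, r) * C $$ (r, j div q)) * (B $$ (i mod k, s) * D $$ (s, j mod q)))"
    by (subst sum_lessThan_prod[symmetric]) (simp add: mult_ac)
  also have "\<dots> = ((A * C) \<otimes>\<^sub>m (B * D)) $$ (i, j)"
    unfolding kron_index[OF mult_carrier_mat[OF assms(1,3)] mult_carrier_mat[OF assms(2,4)] ij]
      mult_mat_index[OF assms(1,3) bounds(1,3)] mult_mat_index[OF assms(2,4) bounds(2,4)]
    by (simp only: sum_product)
  finally show "((A \<otimes>\<^sub>m B) * (C \<otimes>\<^sub>m D)) $$ (i, j) = ((A * C) \<otimes>\<^sub>m (B * D)) $$ (i, j)" .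
qed (use assms in auto)

lemma mat_adjoint_kron: "mat_adjoint (A \<otimes>\<^sub>m B) = mat_adjoint A \<otimes>\<^sub>m mat_adjoint B"
proof (rule eq_matI)
  fix i j assume "i < dim_row (mat_adjoint A \<otimes>\<^sub>m mat_adjoint B)" "j < dim_col (mat_adjoint A \<otimes>\<^sub>m mat_adjoint B)"
  then have "i < dim_col A * dim_col B" "j < dim_row A * dim_row B" by auto
  with div_mod_bounds[OF this(1)] div_mod_bounds[OF this(2)]
  show "mat_adjoint (A \<otimes>\<^sub>m B) $$ (i, j) = (mat_adjoint A \<otimes>\<^sub>m mat_adjoint B) $$ (i, j)"
    by (simp add: kron_def)
qed auto

lemma mat_adjoint_one [simp]: "mat_adjoint (1\<^sub>m n :: complex mat) = 1\<^sub>m n"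
  by (rule eq_matI) auto

lemma kron_one: "1\<^sub>m n \<otimes>\<^sub>m 1\<^sub>m m = 1\<^sub>m (n * m)"
proof (rule eq_matI)
  fix i j assume "i < dim_row (1\<^sub>m (n * m) :: complex mat)" "j < dim_col (1\<^sub>m (n * m) :: complex mat)"
  then have ij: "i < n * m" "j < n * m" by auto
  have "i = j \<longleftrightarrow> i div m = j div m \<and> i mod m = j mod m"
    by (metis div_mult_mod_eq)
  then show "(1\<^sub>m n \<otimes>\<^sub>m 1\<^sub>m m) $$ (i, j) = 1\<^sub>m (n * m) $$ (i, j)"
    using ij div_mod_bounds[OF ij(1)] div_mod_bounds[OF ij(2)] by (auto simp: kron_def)
qed auto

lemma lift_op_carrier:
  assumes "m \<le> n" "A \<in> carrier_mat (2 ^ m) (2 ^ m)"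
  shows "lift_op m n A \<in> carrier_mat (2 ^ n) (2 ^ n)"
proof -
  \<comment> \<open>Subtraction on naturals truncates, so the dimensions match only because of
    \<open>m \<le> n\<close>.\<close>
  have "(2::nat) ^ m * 2 ^ (n - m) = 2 ^ n"
    using assms(1) by (simp flip: power_add)
  then show ?thesis
    using kron_carrier[OF assms(2), of "1\<^sub>m (2 ^ (n - m))" "2 ^ (n - m)" "2 ^ (n - m)"]
    by (simp add: lift_op_def)
qed

text \<open>By the mixed-product rule the lifted operator V again satisfies V\<dagger> V = 1, so
  conjugation by it preserves the trace.\<close>

lemma density_apply_unitary:
  assumes "m \<le> n" "unitary m U" "density n \<rho>"
  shows "density n (apply_unitary m n U \<rho>)"
proof -
  let ?V = "lift_op m n U"
  have U: "U \<in> carrier_mat (2 ^ m) (2 ^ m)" "mat_adjoint U * U = 1\<^sub>m (2 ^ m)"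
    using assms(2) by (auto simp: unitary_def)
  have pow: "(2::nat) ^ m * 2 ^ (n - m) = 2 ^ n"
    using assms(1) by (simp flip: power_add)
  note V = lift_op_carrier[OF assms(1) U(1)]
  have \<rho>: "\<rho> \<in> carrier_mat (2 ^ n) (2 ^ n)" "psd (2 ^ n) (\<lambda>i j. \<rho> $$ (i, j))" "mat_trace \<rho> = 1"
    using assms(3) by (auto simp: density_iff)
  let ?I = "1\<^sub>m (2 ^ (n - m)) :: complex mat"
  have "mat_adjoint ?V * ?V = (mat_adjoint U * U) \<otimes>\<^sub>m (?I * ?I)"
    unfolding lift_op_def mat_adjoint_kron mat_adjoint_one using U(1) by (intro kron_mult) auto
  also have "\<dots> = 1\<^sub>m (2 ^ n)" by (simp add: U(2) kron_one pow)
  finally have "mat_trace (apply_unitary m n U \<rho>) = 1"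
    using \<rho> by (simp add: apply_unitary_def mat_trace_conj[OF V \<rho>(1)])
  then show ?thesis
    using V \<rho> psd_mat_conj[OF V \<rho>(1,2)] unfolding density_iff
    by (auto simp: apply_unitary_def intro!: mult_carrier_mat)
qed

lemma density_kron:
  assumes "density n \<rho>" "density m \<sigma>"
  shows "density (n + m) (\<rho> \<otimes>\<^sub>m \<sigma>)"
proof -
  have \<rho>: "\<rho> \<in> carrier_mat (2 ^ n) (2 ^ n)" "psd (2 ^ n) (\<lambda>i j. \<rho> $$ (i, j))" "mat_trace \<rho> = 1"
    and \<sigma>: "\<sigma> \<in> carrier_mat (2 ^ m) (2 ^ m)" "psd (2 ^ m) (\<lambda>i j. \<sigma> $$ (i, j))" "mat_trace \<sigma> = 1"
    using assms by (auto simp: density_iff)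
  have "psd (2 ^ n * 2 ^ m) (\<lambda>i j. (\<rho> \<otimes>\<^sub>m \<sigma>) $$ (i, j))"
    using psd_kron[OF \<rho>(2) \<sigma>(2)] by (simp add: kron_index[OF \<rho>(1) \<sigma>(1)] cong: psd_cong)
  moreover have "mat_trace (\<rho> \<otimes>\<^sub>m \<sigma>) = 1"
  proof -
    \<comment> \<open>A diagonal index of the product is a pair of diagonal indices, so the trace is
      multiplicative.\<close>
    have "mat_trace (\<rho> \<otimes>\<^sub>m \<sigma>) = (\<Sum>i<2 ^ n * 2 ^ m.
        \<rho> $$ (i div 2 ^ m, i div 2 ^ m) * \<sigma> $$ (i mod 2 ^ m, i mod 2 ^ m))"
      using \<rho>(1) \<sigma>(1) unfolding mat_trace_def by (intro sum.cong) (auto simp: kron_index[OF \<rho>(1) \<sigma>(1)])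
    also have "\<dots> = mat_trace \<rho> * mat_trace \<sigma>"
      using \<rho>(1) \<sigma>(1)
      by (simp add: sum_lessThan_prod[of "\<lambda>i j. \<rho> $$ (i, i) * \<sigma> $$ (j, j)"] mat_trace_def sum_product)
    finally show ?thesis using \<rho> \<sigma> by simp
  qed
  ultimately show ?thesis
    using kron_carrier[OF \<rho>(1) \<sigma>(1)] by (simp add: density_iff power_add)
qed

section \<open>Computational-basis measurement\<close>

lemma lift_basis_proj_carrier:
  "m \<le> n \<Longrightarrow> lift_op m n (basis_proj m i) \<in> carrier_mat (2 ^ n) (2 ^ n)"
  by (rule lift_op_carrier) (simp_all add: basis_proj_def)

text \<open>The first \<open>m\<close> qubits are the leading binary digits of an index, so their
  value is \<open>j div 2 ^ (n - m)\<close>; the lifted projection is a diagonal 0/1 matrix.\<close>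

lemma lift_basis_proj_index:
  assumes "m \<le> n" "j < 2 ^ n" "k < 2 ^ n"
  shows "lift_op m n (basis_proj m i) $$ (j, k) = (if j = k \<and> j div 2 ^ (n - m) = i then 1 else 0)"
proof -
  have pow: "(2::nat) ^ m * 2 ^ (n - m) = 2 ^ n"
    using assms(1) by (simp flip: power_add)
  have jk: "j < 2 ^ m * 2 ^ (n - m)" "k < 2 ^ m * 2 ^ (n - m)" using assms pow by auto
  have "j = k \<longleftrightarrow> j div 2 ^ (n - m) = k div 2 ^ (n - m) \<and> j mod 2 ^ (n - m) = k mod 2 ^ (n - m)"
    by (metis div_mult_mod_eq)
  then show ?thesis
    using jk div_mod_bounds[OF jk(1)] div_mod_bounds[OF jk(2)]
    by (auto simp: lift_op_def kron_def basis_proj_def)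
qed

text \<open>For a diagonal 0/1 matrix P\<dagger> P = P, so the trace collects exactly the diagonal
  entries of \<rho> whose leading digits read \<open>i\<close>.\<close>

lemma mat_trace_meas:
  fixes i :: nat
  assumes "m \<le> n" "\<rho> \<in> carrier_mat (2 ^ n) (2 ^ n)"
  defines "P \<equiv> lift_op m n (basis_proj m i)"
  shows "mat_trace (mat_adjoint P * P * \<rho>) =
    (\<Sum>j<2 ^ n. if j div 2 ^ (n - m) = i then \<rho> $$ (j, j) else 0)"
proof -
  note P = lift_basis_proj_carrier[OF assms(1), of i, folded P_def]
  have PP: "(mat_adjoint P * P) $$ (j, k) = P $$ (j, k)" if "j < 2 ^ n" "k < 2 ^ n" for j k
  proof -
    have "(mat_adjoint P * P) $$ (j, k) = (\<Sum>l<2 ^ n. cnj (P $$ (l, j)) * P $$ (l, k))"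
      using P that by (simp add: mult_mat_index[of _ "2 ^ n" "2 ^ n" _ "2 ^ n"] del: index_mult_mat(1))
    also have "\<dots> = (\<Sum>l<2 ^ n. if l = j then P $$ (j, k) else 0)"
      using that assms(1) by (intro sum.cong refl) (simp add: P_def lift_basis_proj_index)
    finally show ?thesis using that by simp
  qed
  have "mat_trace (mat_adjoint P * P * \<rho>) = (\<Sum>j<2 ^ n. \<Sum>k<2 ^ n. P $$ (j, k) * \<rho> $$ (k, j))"
    unfolding mat_trace_mult[OF mult_carrier_mat[OF mat_adjoint_carrier[OF P] P] assms(2)]
    by (intro sum.cong refl) (simp add: PP del: index_mult_mat(1))
  also have "\<dots> = (\<Sum>j<2 ^ n. \<Sum>k<2 ^ n. if k = j then (if j div 2 ^ (n - m) = i then \<rho> $$ (j, j) else 0) else 0)"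
    using assms(1) by (intro sum.cong refl) (simp add: P_def lift_basis_proj_index)
  finally show ?thesis by simp
qed

text \<open>The diagonal of a density matrix is real, so taking \<open>Re\<close> in
  \<open>meas_prob\<close> loses nothing. The complex equation is what normalizes the
  post-measurement state.\<close>

lemma mat_trace_meas_real:
  fixes i :: nat
  assumes "m \<le> n" "density n \<rho>"
  defines "P \<equiv> lift_op m n (basis_proj m i)"
  shows "mat_trace (mat_adjoint P * P * \<rho>) = complex_of_real (meas_prob m n i \<rho>)"
    and "meas_prob m n i \<rho> = (\<Sum>j<2 ^ n. if j div 2 ^ (n - m) = i then Re (\<rho> $$ (j, j)) else 0)"
proof -
  have \<rho>: "\<rho> \<in> carrier_mat (2 ^ n) (2 ^ n)" "psd (2 ^ n) (\<lambda>i j. \<rho> $$ (i, j))"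
    using assms(2) by (auto simp: density_iff)
  have "mat_trace (mat_adjoint P * P * \<rho>) =
      (\<Sum>j<2 ^ n. if j div 2 ^ (n - m) = i then complex_of_real (Re (\<rho> $$ (j, j))) else 0)"
    unfolding P_def mat_trace_meas[OF assms(1) \<rho>(1)]
    using psd_diag(1)[OF \<rho>(2)] by (intro sum.cong refl) auto
  also have "\<dots> = complex_of_real (\<Sum>j<2 ^ n. if j div 2 ^ (n - m) = i then Re (\<rho> $$ (j, j)) else 0)"
    unfolding of_real_sum by (intro sum.cong refl) simp
  finally have tr: "mat_trace (mat_adjoint P * P * \<rho>) =
    complex_of_real (\<Sum>j<2 ^ n. if j div 2 ^ (n - m) = i then Re (\<rho> $$ (j, j)) else 0)" .
  then show "meas_prob m n i \<rho> = (\<Sum>j<2 ^ n. if j div 2 ^ (n - m) = i then Re (\<rho> $$ (j, j)) else 0)"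
    unfolding meas_prob_def P_def by (simp only: Re_complex_of_real)
  with tr show "mat_trace (mat_adjoint P * P * \<rho>) = complex_of_real (meas_prob m n i \<rho>)"
    by simp
qed

lemma meas_prob_nonneg:
  assumes "m \<le> n" "density n \<rho>"
  shows "0 \<le> meas_prob m n i \<rho>"
  unfolding mat_trace_meas_real(2)[OF assms]
  using assms(2) psd_diag(2)[of "2 ^ n" "\<lambda>i j. \<rho> $$ (i, j)"]
  by (intro sum_nonneg) (auto simp: density_iff)

text \<open>Each basis index belongs to exactly one outcome, so summing over the outcomes runs once
  through the diagonal.\<close>

lemma sum_meas_prob:
  assumes "m \<le> n" "density n \<rho>"
  shows "(\<Sum>i<2 ^ m. meas_prob m n i \<rho>) = 1"
proof -
  have pow: "(2::nat) ^ m * 2 ^ (n - m) = 2 ^ n"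
    using assms(1) by (simp flip: power_add)
  have \<rho>: "\<rho> \<in> carrier_mat (2 ^ n) (2 ^ n)" "mat_trace \<rho> = 1"
    using assms(2) by (auto simp: density_iff)
  have "(\<Sum>i<2 ^ m. meas_prob m n i \<rho>) =
      (\<Sum>j<2 ^ n. \<Sum>i<2 ^ m. if i = j div 2 ^ (n - m) then Re (\<rho> $$ (j, j)) else 0)"
    unfolding mat_trace_meas_real(2)[OF assms]
    by (subst sum.swap) (intro sum.cong refl, auto)
  also have "\<dots> = (\<Sum>j<2 ^ n. Re (\<rho> $$ (j, j)))"
  proof (intro sum.cong refl)
    fix j :: nat assume "j \<in> {..<2 ^ n}"
    then have "j div 2 ^ (n - m) < 2 ^ m" by (intro less_mult_imp_div_less) (simp add: pow)
    then show "(\<Sum>i<2 ^ m. if i = j div 2 ^ (n - m) then Re (\<rho> $$ (j, j)) else 0) = Re (\<rho> $$ (j, j))"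
      by simp
  qed
  also have "\<dots> = Re (mat_trace \<rho>)" using \<rho>(1) by (simp add: mat_trace_def)
  finally show ?thesis using \<rho>(2) by simp
qed

text \<open>The unnormalized state has the outcome probability as its trace, and dividing by this
  positive number keeps it positive semidefinite.\<close>

lemma density_meas_state:
  assumes "m \<le> n" "density n \<rho>" "0 < meas_prob m n i \<rho>"
  shows "density n (meas_state m n i \<rho>)"
proof -
  let ?P = "lift_op m n (basis_proj m i)" and ?p = "meas_prob m n i \<rho>"
  note P = lift_basis_proj_carrier[OF assms(1), of i]
  have \<rho>: "\<rho> \<in> carrier_mat (2 ^ n) (2 ^ n)" "psd (2 ^ n) (\<lambda>i j. \<rho> $$ (i, j))"
    using assms(2) by (auto simp: density_iff)
  let ?S = "?P * \<rho> * mat_adjoint ?P"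
  have S: "?S \<in> carrier_mat (2 ^ n) (2 ^ n)" using P \<rho>(1) by (auto intro!: mult_carrier_mat)
  have psd: "psd (2 ^ n) (\<lambda>j k. complex_of_real (1 / ?p) * ?S $$ (j, k))"
    using assms(3) by (intro psd_scale psd_mat_conj[OF P \<rho>]) simp
  have "meas_state m n i \<rho> $$ (j, k) = complex_of_real (1 / ?p) * ?S $$ (j, k)"
    if "j < 2 ^ n" "k < 2 ^ n" for j k
    unfolding meas_state_def using S that by (intro index_smult_mat) auto
  with psd have "psd (2 ^ n) (\<lambda>j k. meas_state m n i \<rho> $$ (j, k))"
    by (metis (no_types, lifting) psd_cong)
  moreover have "mat_trace (meas_state m n i \<rho>) = complex_of_real (1 / ?p) * mat_trace ?S"
    unfolding meas_state_def mat_trace_def sum_distrib_left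
    by (intro sum.cong) (use S in \<open>auto simp del: index_mult_mat(1)\<close>)
  then have "mat_trace (meas_state m n i \<rho>) = 1"
    using assms(3) by (simp add: mat_trace_conj[OF P \<rho>(1)] mat_trace_meas_real(1)[OF assms(1,2)])
  moreover have "meas_state m n i \<rho> \<in> carrier_mat (2 ^ n) (2 ^ n)"
    unfolding meas_state_def using S by (rule smult_carrier_mat)
  ultimately show ?thesis by (simp add: density_iff)
qed

section \<open>Convex mixtures\<close>

lemma psd_sum_mset:
  "(\<And>p a. (p, a) \<in># M \<Longrightarrow> 0 \<le> p \<and> psd n (\<lambda>i j. a $$ (i, j))) \<Longrightarrow>
    psd n (\<lambda>i j. \<Sum>(p, a)\<in>#M. complex_of_real p * a $$ (i, j))"
  by (induction M) (auto simp: psd_zero intro!: psd_add psd_scale)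

lemma density_mixture:
  assumes "\<And>p \<rho>. (p, \<rho>) \<in># M \<Longrightarrow> 0 \<le> p \<and> density n \<rho>" "(\<Sum>(p, \<rho>)\<in>#M. p) = 1"
  shows "density n (mixture n M)"
proof -
  have "psd (2 ^ n) (\<lambda>i j. \<Sum>(p, \<rho>)\<in>#M. complex_of_real p * \<rho> $$ (i, j))"
    using assms(1) by (intro psd_sum_mset) (auto simp: density_iff)
  then have "psd (2 ^ n) (\<lambda>i j. mixture n M $$ (i, j))"
    by (simp add: mixture_def cong: psd_cong)
  moreover have "mat_trace (mixture n M) = complex_of_real (\<Sum>(p, \<rho>)\<in>#M. p)"
  proof -
    \<comment> \<open>Proved for any total weight, since removing a summand in the induction
      destroys total weight 1.\<close>
    have "(\<Sum>i<2 ^ n. \<Sum>(p, \<rho>)\<in>#M. complex_of_real p * \<rho> $$ (i, i)) = complex_of_real (\<Sum>(p, \<rho>)\<in>#M. p)"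
      using assms(1)
    proof (induction M)
      case (add x M)
      obtain p \<rho> where x: "x = (p, \<rho>)" by (cases x)
      have "density n \<rho>" using add.prems[of p \<rho>] x by simp
      then have "(\<Sum>i<2 ^ n. \<rho> $$ (i, i)) = 1" by (auto simp: density_iff mat_trace_def)
      then have "(\<Sum>i<2 ^ n. complex_of_real p * \<rho> $$ (i, i)) = complex_of_real p"
        by (simp flip: sum_distrib_left)
      moreover have "(\<Sum>i<2 ^ n. \<Sum>(p, \<rho>)\<in>#M. complex_of_real p * \<rho> $$ (i, i)) = complex_of_real (\<Sum>(p, \<rho>)\<in>#M. p)"
        using add.prems by (intro add.IH) auto
      ultimately show ?case by (simp add: x sum.distrib)
    qed simp
    then show ?thesis by (simp add: mat_trace_def mixture_def)
  qed
  moreover have "mixture n M \<in> carrier_mat (2 ^ n) (2 ^ n)" by (simp add: mixture_def)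
  ultimately show ?thesis using assms(2) by (simp add: density_iff)
qed

section \<open>Affine contexts\<close>

text \<open>The context left once index \<open>k\<close> has been substituted away, renumbered as in
  \<open>subst\<close>.\<close>

definition ctx_del :: "nat \<Rightarrow> ctx \<Rightarrow> ctx" where
  "ctx_del k \<Gamma> = (\<lambda>i. if i < k then \<Gamma> i else \<Gamma> (Suc i))"

text \<open>The counterpart of \<open>shift\<close>: the new index \<open>k\<close> is a hole, which
  a partial map can express.\<close>

definition ctx_gap :: "nat \<Rightarrow> ctx \<Rightarrow> ctx" where
  "ctx_gap k \<Gamma> = (\<lambda>i. if i < k then \<Gamma> i else if i = k then None else \<Gamma> (i - 1))"

lemma finite_dom_ctx_cons [simp]: "finite (dom (ctx_cons A \<Gamma>)) \<longleftrightarrow> finite (dom \<Gamma>)"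
proof
  assume "finite (dom (ctx_cons A \<Gamma>))"
  then have "finite (Suc -` dom (ctx_cons A \<Gamma>))"
    by (rule finite_vimageI) simp
  moreover have "Suc -` dom (ctx_cons A \<Gamma>) = dom \<Gamma>"
    by (auto simp: ctx_cons_def)
  ultimately show "finite (dom \<Gamma>)" by simp
next
  assume "finite (dom \<Gamma>)"
  moreover have "dom (ctx_cons A \<Gamma>) \<subseteq> insert 0 (Suc ` dom \<Gamma>)"
    by (force simp: ctx_cons_def split: nat.splits)
  ultimately show "finite (dom (ctx_cons A \<Gamma>))"
    by (meson finite_imageI finite_insert finite_subset)
qed

lemma finite_dom_ctx_gap:
  assumes "finite (dom \<Gamma>)"
  shows "finite (dom (ctx_gap k \<Gamma>))"
proof -
  have "dom (ctx_gap k \<Gamma>) \<subseteq> dom \<Gamma> \<union> Suc ` dom \<Gamma>"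
  proof
    fix i assume "i \<in> dom (ctx_gap k \<Gamma>)"
    then show "i \<in> dom \<Gamma> \<union> Suc ` dom \<Gamma>"
      by (cases i) (auto simp: ctx_gap_def split: if_splits)
  qed
  with assms show ?thesis
    by (meson finite_UnI finite_imageI finite_subset)
qed

lemma finite_dom_ctx_del:
  assumes "finite (dom \<Gamma>)"
  shows "finite (dom (ctx_del k \<Gamma>))"
proof -
  have "finite (Suc -` dom \<Gamma>)"
    using assms by (rule finite_vimageI) simp
  moreover have "dom (ctx_del k \<Gamma>) \<subseteq> dom \<Gamma> \<union> Suc -` dom \<Gamma>"
    by (auto simp: ctx_del_def split: if_splits)
  ultimately show ?thesis
    using assms by (meson finite_UnI finite_subset)
qed

section \<open>Deletion and gaps against binders and disjoint unions\<close>

lemma ctx_cons_mono: "\<Gamma> \<subseteq>\<^sub>m \<Gamma>' \<Longrightarrow> ctx_cons A \<Gamma> \<subseteq>\<^sub>m ctx_cons A \<Gamma>'"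
  by (force simp: map_le_def ctx_cons_def dom_def split: nat.splits)

lemma ctx_cons_gap: "ctx_cons A (ctx_gap k \<Gamma>) = ctx_gap (Suc k) (ctx_cons A \<Gamma>)"
  by (rule ext) (auto simp: ctx_cons_def ctx_gap_def split: nat.splits)

lemma ctx_gap_add: "ctx_gap k (\<Gamma> ++ \<Delta>) = ctx_gap k \<Gamma> ++ ctx_gap k \<Delta>"
  by (rule ext) (auto simp: ctx_gap_def map_add_def split: option.splits)

lemma ctx_gap_disjoint: "dom \<Gamma> \<inter> dom \<Delta> = {} \<Longrightarrow> dom (ctx_gap k \<Gamma>) \<inter> dom (ctx_gap k \<Delta>) = {}"
  by (fastforce simp: ctx_gap_def dom_def disjoint_iff split: if_splits)

text \<open>A letcase branch sees only its bound index 0, so shifting at a positive index leaves its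
  context alone.\<close>

lemma ctx_gap_singleton: "ctx_gap (Suc k) [0 \<mapsto> A] = [0 \<mapsto> A]"
  by (rule ext) (auto simp: ctx_gap_def)

lemma ctx_cons_del: "ctx_cons A (ctx_del k \<Gamma>) = ctx_del (Suc k) (ctx_cons A \<Gamma>)"
  by (rule ext) (auto simp: ctx_cons_def ctx_del_def split: nat.splits)

lemma ctx_del_cons: "ctx_del 0 (ctx_cons A \<Gamma>) = \<Gamma>"
  by (rule ext) (auto simp: ctx_cons_def ctx_del_def)

lemma ctx_del_add: "ctx_del k (\<Gamma> ++ \<Delta>) = ctx_del k \<Gamma> ++ ctx_del k \<Delta>"
  by (rule ext) (auto simp: ctx_del_def map_add_def)

lemma ctx_del_disjoint: "dom \<Gamma> \<inter> dom \<Delta> = {} \<Longrightarrow> dom (ctx_del k \<Gamma>) \<inter> dom (ctx_del k \<Delta>) = {}"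
  by (fastforce simp: ctx_del_def dom_def disjoint_iff split: if_splits)

lemma ctx_del_singleton: "ctx_del (Suc k) [0 \<mapsto> A] = [0 \<mapsto> A]"
  by (rule ext) (auto simp: ctx_del_def)

text \<open>Used when a substitution enters a binder: the context of the substituted term receives a
  gap at 0, in step with \<open>shift s 0\<close>.\<close>

lemma ctx_cons_add: "ctx_cons A (\<Gamma> ++ \<Delta>) = ctx_cons A \<Gamma> ++ ctx_gap 0 \<Delta>"
  by (rule ext) (auto simp: ctx_cons_def ctx_gap_def map_add_def split: nat.splits)

lemma ctx_cons_gap_disjoint:
  "dom \<Gamma> \<inter> dom \<Delta> = {} \<Longrightarrow> dom (ctx_cons A \<Gamma>) \<inter> dom (ctx_gap 0 \<Delta>) = {}"
  by (fastforce simp: ctx_gap_def ctx_cons_def dom_def disjoint_iff split: if_splits nat.splits)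

lemma singleton_eq_ctx_cons: "[0 \<mapsto> A] = ctx_cons A Map.empty"
  by (rule ext) (auto simp: ctx_cons_def split: nat.splits)

lemma map_add_swap:
  assumes "dom \<Delta> \<inter> dom \<Theta> = {}"
  shows "\<Gamma> ++ \<Delta> ++ \<Theta> = \<Gamma> ++ \<Theta> ++ \<Delta>"
  using assms by (metis map_add_assoc map_add_comm)

text \<open>To weaken a split context, all additional variables go to the left component, and
  \<open>\<Delta>\<close> stays as it is.\<close>

lemma weaken_split:
  assumes "\<Gamma> ++ \<Delta> \<subseteq>\<^sub>m \<Theta>" "dom \<Gamma> \<inter> dom \<Delta> = {}"
  obtains \<Gamma>' where "\<Gamma> \<subseteq>\<^sub>m \<Gamma>'" "dom \<Gamma>' \<inter> dom \<Delta> = {}" "\<Gamma>' ++ \<Delta> = \<Theta>" "dom \<Gamma>' \<subseteq> dom \<Theta>"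
proof
  let ?\<Gamma>' = "\<Theta> |` (- dom \<Delta>)"
  have "\<Gamma> \<subseteq>\<^sub>m \<Theta>" "\<Delta> \<subseteq>\<^sub>m \<Theta>"
    using assms by (metis map_add_comm map_le_map_add map_le_trans, metis assms(1) map_le_map_add map_le_trans)
  then show "\<Gamma> \<subseteq>\<^sub>m ?\<Gamma>'"
    using assms(2) by (auto simp: map_le_def restrict_map_def)
  show "dom ?\<Gamma>' \<inter> dom \<Delta> = {}" by auto
  show "?\<Gamma>' ++ \<Delta> = \<Theta>"
    using \<open>\<Delta> \<subseteq>\<^sub>m \<Theta>\<close> by (intro ext) (auto simp: map_le_def map_add_def restrict_map_def dom_def split: option.splits)
  show "dom ?\<Gamma>' \<subseteq> dom \<Theta>" by auto
qed

lemma ctx_del_add_disjoint: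
  assumes "dom \<Gamma> \<inter> dom \<Gamma>' = {}" "dom (ctx_del k (\<Gamma> ++ \<Gamma>')) \<inter> dom \<Delta> = {}"
  shows "dom (ctx_del k \<Gamma>) \<inter> dom \<Delta> = {}" "dom (ctx_del k \<Gamma>') \<inter> dom \<Delta> = {}"
    "dom (ctx_del k \<Gamma>) \<inter> dom (ctx_del k \<Gamma>') = {}"
  using assms ctx_del_disjoint[OF assms(1), of k] by (auto simp: ctx_del_add)

text \<open>An affine context is split at an application, so the substituted variable belongs to at most
  one side; the other side receives the empty context in place of \<open>\<Delta>\<close>.\<close>

lemma ctx_del_add_split:
  assumes "dom \<Gamma> \<inter> dom \<Gamma>' = {}" "dom (ctx_del k (\<Gamma> ++ \<Gamma>')) \<inter> dom \<Delta> = {}"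
    and "\<And>A. (\<Gamma> ++ \<Gamma>') k = Some A \<Longrightarrow> P \<Delta> A" "finite (dom \<Delta>)"
  obtains \<Delta>1 \<Delta>2 where
    "dom (ctx_del k \<Gamma> ++ \<Delta>1) \<inter> dom (ctx_del k \<Gamma>' ++ \<Delta>2) = {}"
    "(ctx_del k \<Gamma> ++ \<Delta>1) ++ (ctx_del k \<Gamma>' ++ \<Delta>2) = ctx_del k (\<Gamma> ++ \<Gamma>') ++ \<Delta>"
    "dom (ctx_del k \<Gamma>) \<inter> dom \<Delta>1 = {}" "dom (ctx_del k \<Gamma>') \<inter> dom \<Delta>2 = {}"
    "\<And>A. \<Gamma> k = Some A \<Longrightarrow> P \<Delta>1 A" "\<And>A. \<Gamma>' k = Some A \<Longrightarrow> P \<Delta>2 A"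
    "finite (dom \<Delta>1)" "finite (dom \<Delta>2)"
proof -
  note d = ctx_del_add_disjoint[OF assms(1,2)]
  show thesis
  proof (cases "\<Gamma> k")
    case None
    show thesis
    proof (rule that[of Map.empty \<Delta>])
      show "\<And>A. \<Gamma>' k = Some A \<Longrightarrow> P \<Delta> A"
        using assms(3) by simp
    qed (use d None assms(4) in \<open>auto simp: ctx_del_add\<close>)
  next
    case (Some A)
    then have None: "\<Gamma>' k = None" using assms(1) by (metis disjoint_iff domI domIff)
    show thesis
    proof (rule that[of \<Delta> Map.empty])
      show "\<And>A. \<Gamma> k = Some A \<Longrightarrow> P \<Delta> A"
        using assms(3) None by (simp add: map_add_def)
      show "(ctx_del k \<Gamma> ++ \<Delta>) ++ (ctx_del k \<Gamma>' ++ Map.empty) = ctx_del k (\<Gamma> ++ \<Gamma>') ++ \<Delta>"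
        using d by (simp add: ctx_del_add map_add_swap Int_commute)
    qed (use d None assms(4) in auto)
  qed
qed

section \<open>Subject reduction for the probabilistic calculus\<close>

lemma typed_finite_dom: "\<Gamma> \<turnstile> t \<Colon> A \<Longrightarrow> finite (dom \<Gamma>)"
  by (induction rule: typed.induct) auto

lemma typed_weaken: "\<Gamma> \<turnstile> t \<Colon> A \<Longrightarrow> \<Gamma> \<subseteq>\<^sub>m \<Gamma>' \<Longrightarrow> finite (dom \<Gamma>') \<Longrightarrow> \<Gamma>' \<turnstile> t \<Colon> A"
proof (induction arbitrary: \<Gamma>' rule: typed.induct)
  case (var \<Gamma> i A)
  then show ?case by (metis domI map_le_def typed.var)
next
  case (lam A \<Gamma> t B)
  then show ?case by (simp add: ctx_cons_mono typed.lam)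
next
  case (app \<Gamma> t A B \<Delta> r)
  from app.prems(1) app.hyps(3) obtain \<Theta>
    where "\<Gamma> \<subseteq>\<^sub>m \<Theta>" "dom \<Theta> \<inter> dom \<Delta> = {}" "\<Theta> ++ \<Delta> = \<Gamma>'" "dom \<Theta> \<subseteq> dom \<Gamma>'"
    by (rule weaken_split)
  with app show ?case by (metis finite_subset typed.app)
next
  case (tens \<Gamma> t n \<Delta> r m)
  from tens.prems(1) tens.hyps(3) obtain \<Theta>
    where "\<Gamma> \<subseteq>\<^sub>m \<Theta>" "dom \<Theta> \<inter> dom \<Delta> = {}" "\<Theta> ++ \<Delta> = \<Gamma>'" "dom \<Theta> \<subseteq> dom \<Gamma>'"
    by (rule weaken_split)
  with tens show ?case by (metis finite_subset typed.tens)
next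
  case (letcase ts m n A \<Gamma> r)
  then show ?case by (intro typed.letcase) simp_all
qed (auto intro: typed.intros)

lemma typed_shift: "\<Gamma> \<turnstile> t \<Colon> A \<Longrightarrow> ctx_gap k \<Gamma> \<turnstile> shift t k \<Colon> A"
proof (induction arbitrary: k rule: typed.induct)
  case (var \<Gamma> i A)
  then show ?case
    using finite_dom_ctx_gap[of \<Gamma> k] by (auto intro!: typed.var) (auto simp: ctx_gap_def)
next
  case (lam A \<Gamma> t B)
  then show ?case by (simp add: ctx_cons_gap typed.lam)
next
  case (letcase ts m n A \<Gamma> r)
  have "[0 \<mapsto> TQ n] \<turnstile> shift t (Suc k) \<Colon> A" if "t \<in> set ts" for t
    using letcase.IH(1)[OF that, of "Suc k"] by (simp only: ctx_gap_singleton)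
  with letcase show ?case by (auto intro!: typed.letcase)
qed (auto intro!: typed.intros ctx_gap_disjoint finite_dom_ctx_gap simp: ctx_gap_add)

text \<open>A typing of \<open>s\<close> is required only if \<open>k\<close> is in
  \<open>\<Gamma>\<close>, because after a split one component lacks \<open>k\<close>. Without that
  typing the finiteness of \<open>\<Delta>\<close> would not follow, so it is a separate
  premise.\<close>

lemma typed_subst:
  "\<Gamma> \<turnstile> t \<Colon> B \<Longrightarrow> (\<And>A. \<Gamma> k = Some A \<Longrightarrow> \<Delta> \<turnstile> s \<Colon> A) \<Longrightarrow> finite (dom \<Delta>) \<Longrightarrow>
    dom (ctx_del k \<Gamma>) \<inter> dom \<Delta> = {} \<Longrightarrow> ctx_del k \<Gamma> ++ \<Delta> \<turnstile> subst t s k \<Colon> B"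
proof (induction arbitrary: k s \<Delta> rule: typed.induct)
  case (var \<Gamma> i A)
  have fin: "finite (dom (ctx_del k \<Gamma> ++ \<Delta>))"
    using var by (simp add: finite_dom_ctx_del)
  show ?case
  proof (cases "i = k")
    case True
    then have "\<Delta> \<turnstile> s \<Colon> A" using var by simp
    \<comment> \<open>Affinity enters here: the other variables of \<open>\<Gamma>\<close> are
      discarded by weakening.\<close>
    then have "ctx_del k \<Gamma> ++ \<Delta> \<turnstile> s \<Colon> A"
      by (rule typed_weaken) (use fin in simp_all)
    with True show ?thesis by simp
  next
    case False
    define j where "j = (if i < k then i else i - 1)"
    have "ctx_del k \<Gamma> j = Some A"
      using False var.hyps by (auto simp: ctx_del_def j_def)
    then have "(ctx_del k \<Gamma> ++ \<Delta>) j = Some A"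
      using var.prems(3) by (metis map_add_comm map_add_find_right)
    with fin have "ctx_del k \<Gamma> ++ \<Delta> \<turnstile> Var j \<Colon> A" by (rule typed.var)
    with False show ?thesis by (simp add: j_def split: if_splits)
  qed
next
  case (lam A \<Gamma> t B)
  have "ctx_del (Suc k) (ctx_cons A \<Gamma>) ++ ctx_gap 0 \<Delta> \<turnstile> subst t (shift s 0) (Suc k) \<Colon> B"
  proof (rule lam.IH)
    show "ctx_gap 0 \<Delta> \<turnstile> shift s 0 \<Colon> A'" if "ctx_cons A \<Gamma> (Suc k) = Some A'" for A'
      using that lam.prems(1) by (intro typed_shift) (simp add: ctx_cons_def)
  qed (use lam.prems in \<open>auto simp only: finite_dom_ctx_gap ctx_cons_del[symmetric] ctx_cons_gap_disjoint\<close>)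
  then show ?case
    by (auto intro!: typed.lam simp: ctx_cons_add ctx_cons_del)
next
  case (app \<Gamma> t A B \<Gamma>' r)
  obtain \<Delta>1 \<Delta>2 where
    "dom (ctx_del k \<Gamma> ++ \<Delta>1) \<inter> dom (ctx_del k \<Gamma>' ++ \<Delta>2) = {}"
    and eq: "(ctx_del k \<Gamma> ++ \<Delta>1) ++ (ctx_del k \<Gamma>' ++ \<Delta>2) = ctx_del k (\<Gamma> ++ \<Gamma>') ++ \<Delta>"
    and "dom (ctx_del k \<Gamma>) \<inter> dom \<Delta>1 = {}" "dom (ctx_del k \<Gamma>') \<inter> dom \<Delta>2 = {}"
    "\<And>A. \<Gamma> k = Some A \<Longrightarrow> \<Delta>1 \<turnstile> s \<Colon> A" "\<And>A. \<Gamma>' k = Some A \<Longrightarrow> \<Delta>2 \<turnstile> s \<Colon> A"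
    "finite (dom \<Delta>1)" "finite (dom \<Delta>2)"
    \<comment> \<open>The abstract predicate of the splitting lemma becomes typability of
      \<open>s\<close>, so the lemma serves both calculi.\<close>
    using ctx_del_add_split[of \<Gamma> \<Gamma>' k \<Delta> "\<lambda>\<Delta> A. \<Delta> \<turnstile> s \<Colon> A"] app.hyps(3) app.prems by blast
  then have "(ctx_del k \<Gamma> ++ \<Delta>1) ++ (ctx_del k \<Gamma>' ++ \<Delta>2) \<turnstile> App (subst t s k) (subst r s k) \<Colon> B"
    by (intro typed.app[where A = A] app.IH)
  then show ?case by (simp only: eq subst.simps)
next
  case (tens \<Gamma> t n \<Gamma>' r m)
  obtain \<Delta>1 \<Delta>2 where
    "dom (ctx_del k \<Gamma> ++ \<Delta>1) \<inter> dom (ctx_del k \<Gamma>' ++ \<Delta>2) = {}"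
    and eq: "(ctx_del k \<Gamma> ++ \<Delta>1) ++ (ctx_del k \<Gamma>' ++ \<Delta>2) = ctx_del k (\<Gamma> ++ \<Gamma>') ++ \<Delta>"
    and "dom (ctx_del k \<Gamma>) \<inter> dom \<Delta>1 = {}" "dom (ctx_del k \<Gamma>') \<inter> dom \<Delta>2 = {}"
    "\<And>A. \<Gamma> k = Some A \<Longrightarrow> \<Delta>1 \<turnstile> s \<Colon> A" "\<And>A. \<Gamma>' k = Some A \<Longrightarrow> \<Delta>2 \<turnstile> s \<Colon> A"
    "finite (dom \<Delta>1)" "finite (dom \<Delta>2)"
    using ctx_del_add_split[of \<Gamma> \<Gamma>' k \<Delta> "\<lambda>\<Delta> A. \<Delta> \<turnstile> s \<Colon> A"] tens.hyps(3) tens.prems by blast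
  then have "(ctx_del k \<Gamma> ++ \<Delta>1) ++ (ctx_del k \<Gamma>' ++ \<Delta>2) \<turnstile> Tens (subst t s k) (subst r s k) \<Colon> TQ (n + m)"
    by (intro typed.tens tens.IH)
  then show ?case by (simp only: eq subst.simps)
next
  case (letcase ts m n A \<Gamma> r)
  have "[0 \<mapsto> TQ n] \<turnstile> subst t (shift s 0) (Suc k) \<Colon> A" if "t \<in> set ts" for t
  proof -
    \<comment> \<open>Index \<open>Suc k\<close> is absent from the branch context, so the premise
      on \<open>s\<close> is vacuous and the empty context can replace
      \<open>\<Delta>\<close>.\<close>
    have "ctx_del (Suc k) [0 \<mapsto> TQ n] ++ Map.empty \<turnstile> subst t (shift s 0) (Suc k) \<Colon> A"
      by (rule letcase.IH(1)[OF that]) auto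
    then show ?thesis by (simp only: ctx_del_singleton map_add_empty)
  qed
  moreover have "ctx_del k \<Gamma> ++ \<Delta> \<turnstile> subst r s k \<Colon> TM m n"
    using letcase.prems by (rule letcase.IH(2))
  ultimately show ?case using letcase.hyps(1) by (auto intro!: typed.letcase)
qed (auto intro!: typed.intros simp: finite_dom_ctx_del)

lemma typed_beta:
  assumes "ctx_cons A \<Gamma> \<turnstile> t \<Colon> B" "\<Delta> \<turnstile> s \<Colon> A" "dom \<Gamma> \<inter> dom \<Delta> = {}"
  shows "\<Gamma> ++ \<Delta> \<turnstile> subst t s 0 \<Colon> B"
  using typed_subst[OF assms(1), of 0 \<Delta> s] assms(2,3) typed_finite_dom[OF assms(2)]
  by (simp add: ctx_del_cons) (simp add: ctx_cons_def)

text \<open>The matrix is typable in any finite context, so the context of the whole letcase enters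
  as that of the substituted matrix, the branch itself contributing no free variables.\<close>

lemma typed_branch:
  assumes "[0 \<mapsto> TQ n] \<turnstile> t \<Colon> A" "density n \<rho>" "finite (dom \<Gamma>)"
  shows "\<Gamma> \<turnstile> subst t (Rho n \<rho>) 0 \<Colon> A"
proof -
  have "Map.empty ++ \<Gamma> \<turnstile> subst t (Rho n \<rho>) 0 \<Colon> A"
    using assms by (intro typed_beta[of "TQ n"] typed.rho) (simp_all add: singleton_eq_ctx_cons)
  then show ?thesis by simp
qed

section \<open>Inversion and induction on the reduction\<close>

inductive_cases typed_LamE: "\<Gamma> \<turnstile> Lam t \<Colon> A"
inductive_cases typed_AppE: "\<Gamma> \<turnstile> App t s \<Colon> A"
inductive_cases typed_RhoE: "\<Gamma> \<turnstile> Rho n \<rho> \<Colon> A"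
inductive_cases typed_UniE: "\<Gamma> \<turnstile> Uni m U t \<Colon> A"
inductive_cases typed_MeasE: "\<Gamma> \<turnstile> Meas m t \<Colon> A"
inductive_cases typed_TensE: "\<Gamma> \<turnstile> Tens t s \<Colon> A"
inductive_cases typed_ResE: "\<Gamma> \<turnstile> Res b m n \<rho> \<Colon> A"
inductive_cases typed_LetcaseE: "\<Gamma> \<turnstile> Letcase t ts \<Colon> A"

lemmas typed_elims = typed_LamE typed_AppE typed_RhoE typed_UniE typed_MeasE typed_TensE typed_ResE
  typed_LetcaseE

lemma typed_red: "t \<rightarrow>\<^bsub>p\<^esub> r \<Longrightarrow> \<Gamma> \<turnstile> t \<Colon> A \<Longrightarrow> \<Gamma> \<turnstile> r \<Colon> A"
proof (induction arbitrary: \<Gamma> A rule: red.induct)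
  case (r_beta t s)
  then show ?case by (auto elim!: typed_elims intro: typed_beta)
next
  case (r_uni m n U \<rho>)
  then show ?case
    by (auto elim!: typed_elims intro!: typed.rho density_apply_unitary)
next
  case (r_meas m n i p \<rho>)
  then show ?case by (auto elim!: typed_elims intro!: typed.res density_meas_state)
next
  case (r_tens n \<rho> n' \<rho>')
  then show ?case by (auto elim!: typed_elims intro!: typed.rho density_kron)
next
  case (r_letcase ts m b n \<rho>)
  then show ?case by (auto elim!: typed_elims intro!: typed_branch)
next
  case (r_lam t p t')
  then show ?case by (auto elim!: typed_LamE intro: typed.lam)
next
  case (r_app1 t p t' s)
  then show ?case by (auto elim!: typed_AppE intro: typed.app)
next
  case (r_app2 t p t' s)
  then show ?case by (auto elim!: typed_AppE intro: typed.app)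
next
  case (r_uni_ctx t p t' m U)
  then show ?case by (auto elim!: typed_UniE intro: typed.uni)
next
  case (r_meas_ctx t p t' m)
  then show ?case by (auto elim!: typed_MeasE intro: typed.meas)
next
  case (r_tens1 t p t' s)
  then show ?case by (auto elim!: typed_TensE intro: typed.tens)
next
  case (r_tens2 t p t' s)
  then show ?case by (auto elim!: typed_TensE intro: typed.tens)
next
  case (r_letcase_ctx t p t' ts)
  then show ?case by (auto elim!: typed_LetcaseE intro: typed.letcase)
qed

section \<open>Subject reduction for the calculus with sums\<close>

lemma otyped_finite_dom: "\<Gamma> \<tturnstile> t \<Colon> A \<Longrightarrow> finite (dom \<Gamma>)"
proof (induction rule: otyped.induct)
  case (osum M \<Gamma> A)
  \<comment> \<open>Total weight 1 excludes the empty sum, which alone would be typable without a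
    premise about \<open>\<Gamma>\<close>.\<close>
  then have "M \<noteq> {#}" by auto
  then show ?case using osum.IH by (metis multiset_nonemptyE surj_pair)
qed auto

lemma otyped_weaken: "\<Gamma> \<tturnstile> t \<Colon> A \<Longrightarrow> \<Gamma> \<subseteq>\<^sub>m \<Gamma>' \<Longrightarrow> finite (dom \<Gamma>') \<Longrightarrow> \<Gamma>' \<tturnstile> t \<Colon> A"
proof (induction arbitrary: \<Gamma>' rule: otyped.induct)
  case (ovar \<Gamma> i A)
  then show ?case by (metis domI map_le_def otyped.ovar)
next
  case (olam A \<Gamma> t B)
  then show ?case by (simp add: ctx_cons_mono otyped.olam)
next
  case (oapp \<Gamma> t A B \<Delta> r)
  from oapp.prems(1) oapp.hyps(3) obtain \<Theta>
    where "\<Gamma> \<subseteq>\<^sub>m \<Theta>" "dom \<Theta> \<inter> dom \<Delta> = {}" "\<Theta> ++ \<Delta> = \<Gamma>'" "dom \<Theta> \<subseteq> dom \<Gamma>'"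
    by (rule weaken_split)
  with oapp show ?case by (metis finite_subset otyped.oapp)
next
  case (otens \<Gamma> t n \<Delta> r m)
  from otens.prems(1) otens.hyps(3) obtain \<Theta>
    where "\<Gamma> \<subseteq>\<^sub>m \<Theta>" "dom \<Theta> \<inter> dom \<Delta> = {}" "\<Theta> ++ \<Delta> = \<Gamma>'" "dom \<Theta> \<subseteq> dom \<Gamma>'"
    by (rule weaken_split)
  with otens show ?case by (metis finite_subset otyped.otens)
next
  case (osum M \<Gamma> A)
  then show ?case by (intro otyped.osum) blast+
next
  case (oletcase ts m n A \<Gamma> r)
  then show ?case by (intro otyped.oletcase) simp_all
qed (auto intro: otyped.intros)

text \<open>Mapping over the summands keeps the weights. This covers shifting, substitution and the
  distribution of an application over a sum.\<close>

lemma otyped_OSum_map: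
  assumes "\<And>p t. (p, t) \<in># M \<Longrightarrow> 0 < p \<and> p \<le> 1" "(\<Sum>(p, t)\<in>#M. p) = 1"
    and "\<And>p t. (p, t) \<in># M \<Longrightarrow> \<Gamma> \<tturnstile> f t \<Colon> A"
  shows "\<Gamma> \<tturnstile> OSum (image_mset (map_prod id f) M) \<Colon> A"
  using assms by (intro otyped.osum) (auto simp: image_mset.compositionality o_def case_prod_unfold)

lemma otyped_shift: "\<Gamma> \<tturnstile> t \<Colon> A \<Longrightarrow> ctx_gap k \<Gamma> \<tturnstile> oshift t k \<Colon> A"
proof (induction arbitrary: k rule: otyped.induct)
  case (ovar \<Gamma> i A)
  then show ?case
    using finite_dom_ctx_gap[of \<Gamma> k] by (auto intro!: otyped.ovar) (auto simp: ctx_gap_def)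
next
  case (olam A \<Gamma> t B)
  then show ?case by (simp add: ctx_cons_gap otyped.olam)
next
  case (oletcase ts m n A \<Gamma> r)
  have "[0 \<mapsto> TQ n] \<tturnstile> oshift t (Suc k) \<Colon> A" if "t \<in> set ts" for t
    using oletcase.IH(1)[OF that, of "Suc k"] by (simp only: ctx_gap_singleton)
  with oletcase show ?case by (auto intro!: otyped.oletcase)
next
  case (osum M \<Gamma> A)
  then show ?case by (simp add: otyped_OSum_map)
qed (auto intro!: otyped.intros ctx_gap_disjoint finite_dom_ctx_gap simp: ctx_gap_add)

lemma otyped_subst:
  "\<Gamma> \<tturnstile> t \<Colon> B \<Longrightarrow> (\<And>A. \<Gamma> k = Some A \<Longrightarrow> \<Delta> \<tturnstile> s \<Colon> A) \<Longrightarrow> finite (dom \<Delta>) \<Longrightarrow>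
    dom (ctx_del k \<Gamma>) \<inter> dom \<Delta> = {} \<Longrightarrow> ctx_del k \<Gamma> ++ \<Delta> \<tturnstile> osubst t s k \<Colon> B"
proof (induction arbitrary: k s \<Delta> rule: otyped.induct)
  case (ovar \<Gamma> i A)
  have fin: "finite (dom (ctx_del k \<Gamma> ++ \<Delta>))"
    using ovar by (simp add: finite_dom_ctx_del)
  show ?case
  proof (cases "i = k")
    case True
    then have "\<Delta> \<tturnstile> s \<Colon> A" using ovar by simp
    then have "ctx_del k \<Gamma> ++ \<Delta> \<tturnstile> s \<Colon> A"
      by (rule otyped_weaken) (use fin in simp_all)
    with True show ?thesis by simp
  next
    case False
    define j where "j = (if i < k then i else i - 1)"
    have "ctx_del k \<Gamma> j = Some A"
      using False ovar.hyps by (auto simp: ctx_del_def j_def)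
    then have "(ctx_del k \<Gamma> ++ \<Delta>) j = Some A"
      using ovar.prems(3) by (metis map_add_comm map_add_find_right)
    with fin have "ctx_del k \<Gamma> ++ \<Delta> \<tturnstile> OVar j \<Colon> A" by (rule otyped.ovar)
    with False show ?thesis by (simp add: j_def split: if_splits)
  qed
next
  case (olam A \<Gamma> t B)
  have "ctx_del (Suc k) (ctx_cons A \<Gamma>) ++ ctx_gap 0 \<Delta> \<tturnstile> osubst t (oshift s 0) (Suc k) \<Colon> B"
  proof (rule olam.IH)
    show "ctx_gap 0 \<Delta> \<tturnstile> oshift s 0 \<Colon> A'" if "ctx_cons A \<Gamma> (Suc k) = Some A'" for A'
      using that olam.prems(1) by (intro otyped_shift) (simp add: ctx_cons_def)
  qed (use olam.prems in \<open>auto simp only: finite_dom_ctx_gap ctx_cons_del[symmetric] ctx_cons_gap_disjoint\<close>)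
  then show ?case
    by (auto intro!: otyped.olam simp: ctx_cons_add ctx_cons_del)
next
  case (oapp \<Gamma> t A B \<Gamma>' r)
  obtain \<Delta>1 \<Delta>2 where
    "dom (ctx_del k \<Gamma> ++ \<Delta>1) \<inter> dom (ctx_del k \<Gamma>' ++ \<Delta>2) = {}"
    and eq: "(ctx_del k \<Gamma> ++ \<Delta>1) ++ (ctx_del k \<Gamma>' ++ \<Delta>2) = ctx_del k (\<Gamma> ++ \<Gamma>') ++ \<Delta>"
    and "dom (ctx_del k \<Gamma>) \<inter> dom \<Delta>1 = {}" "dom (ctx_del k \<Gamma>') \<inter> dom \<Delta>2 = {}"
    "\<And>A. \<Gamma> k = Some A \<Longrightarrow> \<Delta>1 \<tturnstile> s \<Colon> A" "\<And>A. \<Gamma>' k = Some A \<Longrightarrow> \<Delta>2 \<tturnstile> s \<Colon> A"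
    "finite (dom \<Delta>1)" "finite (dom \<Delta>2)"
    using ctx_del_add_split[of \<Gamma> \<Gamma>' k \<Delta> "\<lambda>\<Delta> A. \<Delta> \<tturnstile> s \<Colon> A"] oapp.hyps(3) oapp.prems by blast
  then have "(ctx_del k \<Gamma> ++ \<Delta>1) ++ (ctx_del k \<Gamma>' ++ \<Delta>2) \<tturnstile> OApp (osubst t s k) (osubst r s k) \<Colon> B"
    by (intro otyped.oapp[where A = A] oapp.IH)
  then show ?case by (simp only: eq osubst.simps)
next
  case (otens \<Gamma> t n \<Gamma>' r m)
  obtain \<Delta>1 \<Delta>2 where
    "dom (ctx_del k \<Gamma> ++ \<Delta>1) \<inter> dom (ctx_del k \<Gamma>' ++ \<Delta>2) = {}"
    and eq: "(ctx_del k \<Gamma> ++ \<Delta>1) ++ (ctx_del k \<Gamma>' ++ \<Delta>2) = ctx_del k (\<Gamma> ++ \<Gamma>') ++ \<Delta>"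
    and "dom (ctx_del k \<Gamma>) \<inter> dom \<Delta>1 = {}" "dom (ctx_del k \<Gamma>') \<inter> dom \<Delta>2 = {}"
    "\<And>A. \<Gamma> k = Some A \<Longrightarrow> \<Delta>1 \<tturnstile> s \<Colon> A" "\<And>A. \<Gamma>' k = Some A \<Longrightarrow> \<Delta>2 \<tturnstile> s \<Colon> A"
    "finite (dom \<Delta>1)" "finite (dom \<Delta>2)"
    using ctx_del_add_split[of \<Gamma> \<Gamma>' k \<Delta> "\<lambda>\<Delta> A. \<Delta> \<tturnstile> s \<Colon> A"] otens.hyps(3) otens.prems by blast
  then have "(ctx_del k \<Gamma> ++ \<Delta>1) ++ (ctx_del k \<Gamma>' ++ \<Delta>2) \<tturnstile> OTens (osubst t s k) (osubst r s k) \<Colon> TQ (n + m)"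
    by (intro otyped.otens otens.IH)
  then show ?case by (simp only: eq osubst.simps)
next
  case (oletcase ts m n A \<Gamma> r)
  have "[0 \<mapsto> TQ n] \<tturnstile> osubst t (oshift s 0) (Suc k) \<Colon> A" if "t \<in> set ts" for t
  proof -
    have "ctx_del (Suc k) [0 \<mapsto> TQ n] ++ Map.empty \<tturnstile> osubst t (oshift s 0) (Suc k) \<Colon> A"
      by (rule oletcase.IH(1)[OF that]) auto
    then show ?thesis by (simp only: ctx_del_singleton map_add_empty)
  qed
  moreover have "ctx_del k \<Gamma> ++ \<Delta> \<tturnstile> osubst r s k \<Colon> TM m n"
    using oletcase.prems by (rule oletcase.IH(2))
  ultimately show ?case using oletcase.hyps(1) by (auto intro!: otyped.oletcase)
next
  case (osum M \<Gamma> A)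
  then show ?case by (simp add: otyped_OSum_map)
qed (auto intro!: otyped.intros simp: finite_dom_ctx_del)

lemma otyped_beta:
  assumes "ctx_cons A \<Gamma> \<tturnstile> t \<Colon> B" "\<Delta> \<tturnstile> s \<Colon> A" "dom \<Gamma> \<inter> dom \<Delta> = {}"
  shows "\<Gamma> ++ \<Delta> \<tturnstile> osubst t s 0 \<Colon> B"
  using otyped_subst[OF assms(1), of 0 \<Delta> s] assms(2,3) otyped_finite_dom[OF assms(2)]
  by (simp add: ctx_del_cons) (simp add: ctx_cons_def)

lemma otyped_branch:
  assumes "[0 \<mapsto> TQ n] \<tturnstile> t \<Colon> A" "density n \<rho>" "finite (dom \<Gamma>)"
  shows "\<Gamma> \<tturnstile> osubst t (ORho n \<rho>) 0 \<Colon> A"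
proof -
  have "Map.empty ++ \<Gamma> \<tturnstile> osubst t (ORho n \<rho>) 0 \<Colon> A"
    using assms by (intro otyped_beta[of "TQ n"] otyped.orho) (simp_all add: singleton_eq_ctx_cons)
  then show ?thesis by simp
qed

section \<open>Inversion and induction on the reduction with sums\<close>

inductive_cases otyped_OLamE: "\<Gamma> \<tturnstile> OLam t \<Colon> A"
inductive_cases otyped_OAppE: "\<Gamma> \<tturnstile> OApp t s \<Colon> A"
inductive_cases otyped_ORhoE: "\<Gamma> \<tturnstile> ORho n \<rho> \<Colon> A"
inductive_cases otyped_OUniE: "\<Gamma> \<tturnstile> OUni m U t \<Colon> A"
inductive_cases otyped_OMeasE: "\<Gamma> \<tturnstile> OMeas m t \<Colon> A"
inductive_cases otyped_OTensE: "\<Gamma> \<tturnstile> OTens t s \<Colon> A"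
inductive_cases otyped_OLetcaseE: "\<Gamma> \<tturnstile> OLetcase t ts \<Colon> A"
inductive_cases otyped_OSumE: "\<Gamma> \<tturnstile> OSum M \<Colon> A"

lemmas otyped_elims = otyped_OLamE otyped_OAppE otyped_ORhoE otyped_OUniE otyped_OMeasE otyped_OTensE
  otyped_OLetcaseE otyped_OSumE

lemma otyped_meas_sum:
  assumes "m \<le> n" "length ts = 2 ^ m" "density n \<rho>" "finite (dom \<Gamma>)"
    and "\<And>t. t \<in> set ts \<Longrightarrow> [0 \<mapsto> TQ n] \<tturnstile> t \<Colon> A"
  shows "\<Gamma> \<tturnstile> OSum {#(meas_prob m n i \<rho>, osubst (ts ! i) (ORho n (meas_state m n i \<rho>)) 0).
      i \<in># mset_set {i. i < 2 ^ m \<and> 0 < meas_prob m n i \<rho>}#} \<Colon> A"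
proof (rule otyped.osum, goal_cases)
  let ?I = "{i. i < 2 ^ m \<and> 0 < meas_prob m n i \<rho>}"
  have sum: "(\<Sum>i\<in>?I. meas_prob m n i \<rho>) = 1"
  proof -
    have "(\<Sum>i\<in>?I. meas_prob m n i \<rho>) = (\<Sum>i<2 ^ m. meas_prob m n i \<rho>)"
      \<comment> \<open>An omitted outcome has a probability that is nonnegative but not positive,
        hence 0.\<close>
      using meas_prob_nonneg[OF assms(1,3)] by (intro sum.mono_neutral_left) (auto simp: less_le)
    then show ?thesis by (simp add: sum_meas_prob[OF assms(1,3)])
  qed
  {
    case (1 p t)
    then obtain i where i: "i \<in> ?I" "p = meas_prob m n i \<rho>" by auto
    \<comment> \<open>The bound \<open>p \<le> 1\<close> comes from the total: each term of a sum of
      positive numbers is at most the sum.\<close>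
    have "meas_prob m n i \<rho> \<le> (\<Sum>i\<in>?I. meas_prob m n i \<rho>)"
      using i(1) by (intro member_le_sum) auto
    then show ?case using i sum by simp
  next
    case 2
    show ?case using sum by (simp add: image_mset.compositionality o_def sum_unfold_sum_mset)
  next
    case (3 p t)
    then show ?case using assms by (auto intro!: otyped_branch density_meas_state)
  }
qed

lemma otyped_ored: "t \<rightarrow>\<^sup>\<circ> r \<Longrightarrow> \<Gamma> \<tturnstile> t \<Colon> A \<Longrightarrow> \<Gamma> \<tturnstile> r \<Colon> A"
proof (induction arbitrary: \<Gamma> A rule: ored.induct)
  case (or_beta t s)
  then show ?case by (auto elim!: otyped_elims intro: otyped_beta)
next
  case (or_uni m n U \<rho>)
  then show ?case by (auto elim!: otyped_elims intro!: otyped.orho density_apply_unitary)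
next
  case (or_letcase m n ts \<rho>)
  from or_letcase.prems have
    ts: "\<And>t. t \<in> set ts \<Longrightarrow> [0 \<mapsto> TQ n] \<tturnstile> t \<Colon> A" and "density n \<rho>" "finite (dom \<Gamma>)"
    by (auto elim!: otyped_OLetcaseE otyped_OMeasE otyped_ORhoE)
  with or_letcase.hyps show ?case by (intro otyped_meas_sum)
next
  case (or_tens n \<rho> n' \<rho>')
  then show ?case by (auto elim!: otyped_elims intro!: otyped.orho density_kron)
next
  case (or_mix n M)
  from or_mix.prems have p: "\<And>p \<rho>. (p, \<rho>) \<in># M \<Longrightarrow> 0 < p"
    and sum: "(\<Sum>(p, \<rho>)\<in>#M. p) = 1"
    and typing: "\<And>p \<rho>. (p, \<rho>) \<in># M \<Longrightarrow> \<Gamma> \<tturnstile> ORho n \<rho> \<Colon> A"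
    by (elim otyped_OSumE; force simp: image_mset.compositionality o_def case_prod_unfold)+
  \<comment> \<open>Some summand exists because the weights add up to 1; inverting its typing fixes
    \<open>A\<close>.\<close>
  from sum have "M \<noteq> {#}" by auto
  then obtain q \<sigma> where "(q, \<sigma>) \<in># M" by (metis multiset_nonemptyE surj_pair)
  from typing[OF this] have "A = TQ n" "finite (dom \<Gamma>)" by (auto elim: otyped_ORhoE)
  moreover have "density n \<rho>" if "(p, \<rho>) \<in># M" for p \<rho>
    using typing[OF that] by (rule otyped_ORhoE)
  then have "density n (mixture n M)"
    using p sum by (intro density_mixture) (auto simp: less_imp_le)
  ultimately show ?case by (simp add: otyped.orho)
next
  case (or_idem M t)
  then obtain p where "p \<in># M" by (meson multiset_nonemptyE)
  then have "(p, t) \<in># {#(p, t). p \<in># M#}" by simp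
  with or_idem.prems show ?case by (blast elim: otyped_OSumE)
next
  case (or_app_sum M s)
  \<comment> \<open>The argument \<open>s\<close> is copied into every summand. This respects
    affinity because the sum rule types all summands in one shared context instead of splitting
    it.\<close>
  from or_app_sum.prems obtain \<Gamma>' \<Delta> B where eq: "\<Gamma> = \<Gamma>' ++ \<Delta>" "dom \<Gamma>' \<inter> dom \<Delta> = {}"
    and s: "\<Delta> \<tturnstile> s \<Colon> B" and M: "\<Gamma>' \<tturnstile> OSum M \<Colon> B \<multimap> A"
    by (auto elim: otyped_OAppE)
  from M have "\<Gamma> \<tturnstile> OSum (image_mset (map_prod id (\<lambda>t. OApp t s)) M) \<Colon> A"
    unfolding eq(1) using s eq(2)
    by (elim otyped_OSumE) (auto intro!: otyped_OSum_map otyped.oapp)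
  then show ?case by (simp add: map_prod_def)
next
  case (or_lam t t')
  then show ?case by (auto elim!: otyped_OLamE intro: otyped.olam)
next
  case (or_app1 t t' s)
  then show ?case by (auto elim!: otyped_OAppE intro: otyped.oapp)
next
  case (or_app2 t t' s)
  then show ?case by (auto elim!: otyped_OAppE intro: otyped.oapp)
next
  case (or_uni_ctx t t' m U)
  then show ?case by (auto elim!: otyped_OUniE intro: otyped.ouni)
next
  case (or_meas_ctx t t' m)
  then show ?case by (auto elim!: otyped_OMeasE intro: otyped.omeas)
next
  case (or_tens1 t t' s)
  then show ?case by (auto elim!: otyped_OTensE intro: otyped.otens)
next
  case (or_tens2 t t' s)
  then show ?case by (auto elim!: otyped_OTensE intro: otyped.otens)
next
  case (or_letcase_ctx t t' ts)
  then show ?case by (auto elim!: otyped_OLetcaseE intro: otyped.oletcase)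
next
  case (or_sum_ctx t t' p M)
  \<comment> \<open>The step changes one summand and no weight, so only that summand needs the
    induction hypothesis.\<close>
  from or_sum_ctx.prems show ?case
  proof (rule otyped_OSumE)
    assume w: "\<And>q u. (q, u) \<in># add_mset (p, t) M \<Longrightarrow> 0 < q \<and> q \<le> 1"
      and "(\<Sum>(q, u)\<in>#add_mset (p, t) M. q) = 1"
      and typing: "\<And>q u. (q, u) \<in># add_mset (p, t) M \<Longrightarrow> \<Gamma> \<tturnstile> u \<Colon> A"
    then show ?thesis
      using or_sum_ctx.IH[OF typing[of p t]] w[of p t] by (intro otyped.osum) auto
  qed
qed

theorem theorem3:
  shows "(\<forall>\<Gamma> t A p r. \<Gamma> \<turnstile> t \<Colon> A \<longrightarrow> t \<rightarrow>\<^bsub>p\<^esub> r \<longrightarrow> \<Gamma> \<turnstile> r \<Colon> A) \<and>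
    (\<forall>\<Gamma> t A r. \<Gamma> \<tturnstile> t \<Colon> A \<longrightarrow> t \<rightarrow>\<^sup>\<circ> r \<longrightarrow> \<Gamma> \<tturnstile> r \<Colon> A)"
  using typed_red otyped_ored by blast

end
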